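(* Let $\vartheta>0$ and $H\in(1/2,1)$. The least squares estimator $$\bar\vartheta_T=-\frac{X_T^2}{2\int_0^T X_t^2dt}+\frac{\alpha_H\int_0^T\int_0^t e^{-\vartheta(t-s)}\big((t-s)^{2H-2}+(t+s)^{2H-2}\big)\,ds\,dt}{\int_0^T X_t^2dt}+\frac{T}{2\int_0^T X_t^2dt}$$ converges to $\vartheta$ in probability as $T\to\infty$: for every $\varepsilon>0$, $\lim_{T\to\infty}\mathbf P(|\bar\vartheta_T-\vartheta|>\varepsilon)=0$.
   Context: $\alpha_H=H(2H-1)$. A sub-fractional Brownian motion $S^H$ is a centered Gaussian process with $S^H_0=0$ and covariance $\mathbf E(S^H_tS^H_s)=t^{2H}+s^{2H}-\frac12(|t-s|^{2H}+(t+s)^{2H})$; the mixed sub-fractional Brownian motion is $\xi_t=W_t+S^H_t$ with $W$ a standard Brownian motion independent of $S^H$. The mixed sub-fractional Ornstein–Uhlenbeck process is $X_t=\int_0^t e^{-\vartheta(t-s)}d\xi_s$, i.e. the solution of $dX_t=-\vartheta X_tdt+d\xi_t$, $X_0=0$. *)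

theory Defs
  imports "HOL-Probability.Probability"
begin

text \<open>A real-valued process indexed by time t >= 0 is a map Y :: real => 'a => real.
  Centered Gaussian process with covariance C: every finite linear combination
  of the Y t_i (t_i >= 0) is a centered normal variable (possibly degenerate) with variance
  sum_i sum_j c_i c_j C t_i t_j, expressed via its characteristic function.\<close>

definition centered_gaussian_process ::
  "'a measure \<Rightarrow> (real \<Rightarrow> 'a \<Rightarrow> real) \<Rightarrow> (real \<Rightarrow> real \<Rightarrow> real) \<Rightarrow> bool" where
  "centered_gaussian_process M Y C \<longleftrightarrow>
     (\<forall>t\<ge>0. Y t \<in> borel_measurable M) \<and>
     (\<forall>(ts::real list) (cs::real list) (u::real).
        length cs = length ts \<longrightarrow> (\<forall>t\<in>set ts. t \<ge> 0) \<longrightarrow>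
        char (distr M borel (\<lambda>\<omega>. \<Sum>i<length ts. cs!i * Y (ts!i) \<omega>)) u
        = complex_of_real (exp (- (\<Sum>i<length ts. \<Sum>j<length ts.
                 cs!i * cs!j * C (ts!i) (ts!j)) * u\<^sup>2 / 2)))"

definition brownian_motion :: "'a measure \<Rightarrow> (real \<Rightarrow> 'a \<Rightarrow> real) \<Rightarrow> bool" where
  "brownian_motion M W \<longleftrightarrow>
     centered_gaussian_process M W (\<lambda>s t. min s t) \<and>
     (\<forall>\<omega>\<in>space M. W 0 \<omega> = 0 \<and> continuous_on {0..} (\<lambda>t. W t \<omega>))"

definition subfBm_cov :: "real \<Rightarrow> real \<Rightarrow> real \<Rightarrow> real" where
  "subfBm_cov H t s = t powr (2*H) + s powr (2*H)
      - (\<bar>t - s\<bar> powr (2*H) + (t + s) powr (2*H)) / 2"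

definition sub_fbm :: "'a measure \<Rightarrow> real \<Rightarrow> (real \<Rightarrow> 'a \<Rightarrow> real) \<Rightarrow> bool" where
  "sub_fbm M H S \<longleftrightarrow>
     centered_gaussian_process M S (subfBm_cov H) \<and>
     (\<forall>\<omega>\<in>space M. S 0 \<omega> = 0 \<and> continuous_on {0..} (\<lambda>t. S t \<omega>))"

definition indep_processes :: "'a measure \<Rightarrow> (real \<Rightarrow> 'a \<Rightarrow> real) \<Rightarrow> (real \<Rightarrow> 'a \<Rightarrow> real) \<Rightarrow> bool" where
  "indep_processes M W S \<longleftrightarrow>
     prob_space.indep_var M (Pi\<^sub>M {0..} (\<lambda>_. borel)) (\<lambda>\<omega>. \<lambda>t\<in>{0..}. W t \<omega>)
                            (Pi\<^sub>M {0..} (\<lambda>_. borel)) (\<lambda>\<omega>. \<lambda>t\<in>{0..}. S t \<omega>)"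

definition alpha_H :: "real \<Rightarrow> real" where
  "alpha_H H = H * (2*H - 1)"

text \<open>Mixed sub-fractional OU process X_t = int_0^t e^{-theta(t-s)} d xi_s, xi = W + S,
  written pathwise via integration by parts (xi_0 = 0, continuous paths):
  X_t = xi_t - theta * int_0^t e^{-theta(t-s)} xi_s ds, the solution of
  dX = -theta X dt + d xi, X_0 = 0.\<close>
definition msfOU :: "real \<Rightarrow> (real \<Rightarrow> 'a \<Rightarrow> real) \<Rightarrow> (real \<Rightarrow> 'a \<Rightarrow> real) \<Rightarrow> real \<Rightarrow> 'a \<Rightarrow> real" where
  "msfOU \<theta> W S t \<omega> = (W t \<omega> + S t \<omega>)
     - \<theta> * (LBINT s=0..t. exp (- \<theta> * (t - s)) * (W s \<omega> + S s \<omega>))"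

definition corr_term :: "real \<Rightarrow> real \<Rightarrow> real \<Rightarrow> real" where
  "corr_term \<theta> H T = (LBINT t=0..T. (LBINT s=0..t.
      exp (- \<theta> * (t - s)) * ((t - s) powr (2*H - 2) + (t + s) powr (2*H - 2))))"

definition lse :: "real \<Rightarrow> real \<Rightarrow> (real \<Rightarrow> 'a \<Rightarrow> real) \<Rightarrow> real \<Rightarrow> 'a \<Rightarrow> real" where
  "lse \<theta> H X T \<omega> =
     (let I = (LBINT t=0..T. (X t \<omega>)\<^sup>2) in
       - (X T \<omega>)\<^sup>2 / (2 * I) + alpha_H H * corr_term \<theta> H T / I + T / (2 * I))"

end

theory Submission
  imports Defs
begin

text \<open>
  Put \<open>\<xi> = W + S\<close> and let \<open>X\<close> be the Ornstein-Uhlenbeck process driven by \<open>\<xi>\<close>. Pointwise limits of Riemann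
  sums show that \<open>X\<close> is jointly Gaussian, so the variance of \<open>I = \<integral>\<^sub>0\<^sup>T X\<^sub>t\<^sup>2 dt\<close> is \<open>2 \<integral>\<integral> \<rho>\<^sup>2\<close>, where \<open>\<rho>\<close> is the
  covariance of \<open>X\<close>.

  The covariance of \<open>\<xi>\<close> is the distribution function of a positive measure \<open>\<mu>\<close> on the quadrant
  (Lebesgue measure on the diagonal plus a density \<open>|u-v|^(2H-2) - (u+v)^(2H-2)\<close> times \<open>\<alpha>\<^sub>H\<close>), hence
  \<open>\<rho>(s,t) = \<integral> e\<^sub>s(u) e\<^sub>t(v) d\<mu>\<close> with \<open>e\<^sub>t(u) = 1[u \<le> t] exp(-\<theta>(t-u))\<close>. This makes \<open>\<rho>\<close> nonnegative and bounded by
  some \<open>B\<close>, so no decay of correlations has to be estimated: \<open>\<integral>\<integral> \<rho>\<^sup>2 \<le> B \<integral>\<integral> \<rho> \<le> B \<mu>([0,T]\<^sup>2) / \<theta>\<^sup>2 = O(T^(2H))\<close>,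
  which is \<open>o(T\<^sup>2)\<close>. Integrating the kernel in time gives the energy identity
  \<open>\<rho>(T,T) + 2\<theta> E I = \<integral> exp(-\<theta>|u-v|) d\<mu>\<close>, whose right-hand side is \<open>T\<close> plus twice the correction term of the
  estimator up to \<open>O(T^(2H-1))\<close>. Thus \<open>I/T\<close> concentrates around a mean bounded away from \<open>0\<close>, and the numerator of
  the estimator minus \<open>\<theta> I\<close> is \<open>o(T)\<close> in probability.
\<close>

section \<open>Centered normal variables\<close>

text \<open>No stochastic integral is ever built. The filter \<open>exp_filter\<close> is linear and
  acts on deterministic functions as well as on paths: applied to each argument of the covariance of
  \<xi> it passes under the integral against \<mu> and turns the step function 1[u <= r] of r into
  the exponential kernel, which takes the place of an isometry for Wiener integrals. Both bounds on
  H enter through \<mu>. For H > 1/2 the factor in front of the density is positive and the exponent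
  2H-2 > -1 is integrable across the diagonal; for H < 1 that exponent is negative, so |u-v| <= u+v
  makes the density nonnegative. The obstacle avoided is the threshold H = 3/4: correlations
  decaying like |t-s|^(2H-2) are square integrable only below it, whereas trading one factor \<rho>
  for its bound B treats all H alike. The estimator is not exactly centered: its correction term
  adds (t+s)^(2H-2) where the covariance density subtracts it, and this mismatch is the error of
  order T^(2H-1).\<close>

definition centered_normal :: "'a measure \<Rightarrow> real \<Rightarrow> ('a \<Rightarrow> real) \<Rightarrow> bool" where
  "centered_normal M v Y \<longleftrightarrow> Y \<in> borel_measurable M \<and>
     (\<forall>u. char (distr M borel Y) u = complex_of_real (exp (- v * u\<^sup>2 / 2)))"

context prob_space
begin

lemma centered_normal_measurable [measurable_dest]:
  "centered_normal M v Y \<Longrightarrow> Y \<in> borel_measurable M"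
  by (simp add: centered_normal_def)

text \<open>Nothing in the definition restricts the sign of \<open>v\<close>; it follows from the
  bound 1 on the modulus of a characteristic function, taken at the point 1.\<close>

lemma centered_normal_var_nonneg:
  assumes "centered_normal M v Y" shows "0 \<le> v"
proof -
  have [measurable]: "Y \<in> borel_measurable M"
    using assms by (rule centered_normal_measurable)
  interpret D: real_distribution "distr M borel Y"
    by (rule real_distribution_distr) simp
  have "exp (- v / 2) \<le> 1"
    using assms D.cmod_char_le_1[of 1] by (simp add: centered_normal_def)
  then show ?thesis by simp
qed

text \<open>Scaling a standard normal variable by \<open>sqrt v\<close> includes the degenerate case
  \<open>v = 0\<close> and hands all moments over to the standard normal law.\<close>

lemma centered_normal_distr:
  assumes "centered_normal M v Y"
  shows "distr M borel Y = distr std_normal_distribution borel (\<lambda>x. sqrt v * x)"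
proof (rule Levy_uniqueness)
  have [measurable]: "Y \<in> borel_measurable M"
    using assms by (rule centered_normal_measurable)
  interpret N: real_distribution std_normal_distribution by (rule real_dist_normal_dist)
  show "real_distribution (distr M borel Y)"
    by (rule real_distribution_distr) simp
  show "real_distribution (distr std_normal_distribution borel (\<lambda>x. sqrt v * x))"
    by (rule N.real_distribution_distr) simp
  have "char (distr std_normal_distribution borel (\<lambda>x. sqrt v * x)) u = char std_normal_distribution (u * sqrt v)" for u
    unfolding char_def by (subst integral_distr) (auto simp: mult.assoc)
  then show "char (distr M borel Y) = char (distr std_normal_distribution borel (\<lambda>x. sqrt v * x))"
    using assms centered_normal_var_nonneg[OF assms]
    by (intro ext) (simp add: centered_normal_def char_std_normal_distribution power_mult_distrib mult.commute)
qed

lemma centered_normal_moments: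
  assumes "centered_normal M v Y"
  shows "integrable M (\<lambda>\<omega>. Y \<omega> ^ k)"
    and "expectation (\<lambda>\<omega>. (Y \<omega>)\<^sup>2) = v"
    and "expectation (\<lambda>\<omega>. Y \<omega> ^ 4) = 3 * v\<^sup>2"
proof -
  have [measurable]: "Y \<in> borel_measurable M"
    using assms by (rule centered_normal_measurable)
  have v: "0 \<le> v" using assms by (rule centered_normal_var_nonneg)
  have int: "integrable std_normal_distribution (\<lambda>x. (sqrt v * x) ^ k)" for k
    unfolding power_mult_distrib
    by (intro integrable_mult_right integrable_std_normal_distribution_moment)
  have "integrable (distr M borel Y) (\<lambda>x. x ^ k)"
    unfolding centered_normal_distr[OF assms]
    by (subst integrable_distr_eq) (auto intro: int)
  then show "integrable M (\<lambda>\<omega>. Y \<omega> ^ k)"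
    by (subst (asm) integrable_distr_eq) auto
  have E: "expectation (\<lambda>\<omega>. Y \<omega> ^ k) = sqrt v ^ k * (LINT x|std_normal_distribution. x ^ k)" for k
  proof -
    have "expectation (\<lambda>\<omega>. Y \<omega> ^ k) = (LINT x|distr M borel Y. x ^ k)"
      by (subst integral_distr) auto
    also have "\<dots> = (LINT x|std_normal_distribution. (sqrt v * x) ^ k)"
      unfolding centered_normal_distr[OF assms] by (subst integral_distr) auto
    finally show ?thesis unfolding power_mult_distrib by simp
  qed
  show "expectation (\<lambda>\<omega>. (Y \<omega>)\<^sup>2) = v"
    using E[of 2] std_normal_distribution_even_moments(1)[of 1] v by simp
  have "sqrt v ^ 4 = v\<^sup>2" using v
    by (simp add: power4_eq_xxxx power2_eq_square)
  then show "expectation (\<lambda>\<omega>. Y \<omega> ^ 4) = 3 * v\<^sup>2"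
    using E[of 4] std_normal_distribution_even_moments(1)[of 2] by (simp add: fact_numeral)
qed

text \<open>Dominated convergence gives convergence of the characteristic functions. What needs an
  argument is that the variances converge: they could run off to infinity, and continuity of the
  limiting characteristic function at 0 excludes this.\<close>

lemma centered_normal_limit:
  assumes Y: "\<And>n. centered_normal M (v n) (Y n)"
    and lim: "\<And>\<omega>. \<omega> \<in> space M \<Longrightarrow> (\<lambda>n. Y n \<omega>) \<longlonglongrightarrow> Z \<omega>"
  shows "\<exists>w. centered_normal M w Z"
proof -
  have [measurable]: "Y n \<in> borel_measurable M" for n
    using Y by (rule centered_normal_measurable)
  have [measurable]: "Z \<in> borel_measurable M"
    by (rule borel_measurable_LIMSEQ_real[OF lim]) auto
  interpret D: real_distribution "distr M borel Z"
    by (rule real_distribution_distr) simp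
  have char_eq: "char (distr M borel V) u = expectation (\<lambda>\<omega>. iexp (u * V \<omega>))"
    if [measurable]: "V \<in> borel_measurable M" for V u
    unfolding char_def by (subst integral_distr) auto
  have conv: "(\<lambda>n. complex_of_real (exp (- v n * u\<^sup>2 / 2))) \<longlonglongrightarrow> char (distr M borel Z) u" for u
  proof -
    have "(\<lambda>n. expectation (\<lambda>\<omega>. iexp (u * Y n \<omega>))) \<longlonglongrightarrow> expectation (\<lambda>\<omega>. iexp (u * Z \<omega>))"
    proof (rule integral_dominated_convergence[where w="\<lambda>_. 1"])
      show "AE \<omega> in M. (\<lambda>n. iexp (u * Y n \<omega>)) \<longlonglongrightarrow> iexp (u * Z \<omega>)"
        using lim by (intro AE_I2 tendsto_intros) auto
    qed auto
    moreover have "expectation (\<lambda>\<omega>. iexp (u * Y n \<omega>)) = complex_of_real (exp (- v n * u\<^sup>2 / 2))" for n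
      using Y[of n] by (simp add: char_eq centered_normal_def)
    ultimately show ?thesis by (simp add: char_eq)
  qed
  have "(\<lambda>u. char (distr M borel Z) u) \<midarrow>0\<rightarrow> 1"
    using D.isCont_char[of 0] by (simp add: isCont_def D.char_zero)
  then have "eventually (\<lambda>u. char (distr M borel Z) u \<noteq> 0) (at 0)"
    by (rule tendsto_imp_eventually_ne) simp
  then obtain d where d: "d > 0" "\<And>u. u \<noteq> 0 \<Longrightarrow> \<bar>u\<bar> < d \<Longrightarrow> char (distr M borel Z) u \<noteq> 0"
    by (auto simp: eventually_at)
  define u0 where "u0 = d / 2"
  have u0: "u0 > 0" "char (distr M borel Z) u0 \<noteq> 0"
    using d by (auto simp: u0_def)
  \<comment> \<open>A single point \<open>u0\<close> where the limit does not vanish suffices: the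
    logarithm there recovers \<open>v n\<close> from the characteristic function.\<close>
  have "(\<lambda>n. norm (complex_of_real (exp (- v n * u0\<^sup>2 / 2)))) \<longlonglongrightarrow> norm (char (distr M borel Z) u0)"
    by (intro tendsto_norm conv)
  then have "(\<lambda>n. ln (exp (- v n * u0\<^sup>2 / 2))) \<longlonglongrightarrow> ln (norm (char (distr M borel Z) u0))"
    using u0 by (intro tendsto_ln) auto
  then have "(\<lambda>n. (- 2 / u0\<^sup>2) * (- v n * u0\<^sup>2 / 2)) \<longlonglongrightarrow> (- 2 / u0\<^sup>2) * ln (norm (char (distr M borel Z) u0))"
    by (intro tendsto_mult_left) simp
  moreover have "(- 2 / u0\<^sup>2) * (- v n * u0\<^sup>2 / 2) = v n" for n
    using u0(1) by simp
  ultimately obtain w where w: "v \<longlonglongrightarrow> w" by auto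
  have "(\<lambda>n. complex_of_real (exp (- v n * u\<^sup>2 / 2))) \<longlonglongrightarrow> complex_of_real (exp (- w * u\<^sup>2 / 2))" for u
    by (intro tendsto_intros w) auto
  then have "char (distr M borel Z) u = complex_of_real (exp (- w * u\<^sup>2 / 2))" for u
    using conv LIMSEQ_unique by blast
  then show ?thesis by (auto simp: centered_normal_def)
qed

section \<open>Mixed second and fourth moments\<close>

lemma integrable_product_of_squares:
  fixes Y Z :: "'a \<Rightarrow> real"
  assumes [measurable]: "Y \<in> borel_measurable M" "Z \<in> borel_measurable M"
    and "integrable M (\<lambda>\<omega>. (Y \<omega>)\<^sup>2)" "integrable M (\<lambda>\<omega>. (Z \<omega>)\<^sup>2)"
  shows "integrable M (\<lambda>\<omega>. Y \<omega> * Z \<omega>)"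
    and "expectation (\<lambda>\<omega>. \<bar>Y \<omega> * Z \<omega>\<bar>) \<le> (expectation (\<lambda>\<omega>. (Y \<omega>)\<^sup>2) + expectation (\<lambda>\<omega>. (Z \<omega>)\<^sup>2)) / 2"
proof -
  have b: "\<bar>y * z\<bar> * 2 \<le> y\<^sup>2 + z\<^sup>2" for y z :: real
    using sum_squares_bound[of "\<bar>y\<bar>" "\<bar>z\<bar>"] by (simp add: abs_mult)
  have i: "integrable M (\<lambda>\<omega>. ((Y \<omega>)\<^sup>2 + (Z \<omega>)\<^sup>2) / 2)"
    using assms by auto
  show *: "integrable M (\<lambda>\<omega>. Y \<omega> * Z \<omega>)"
    by (rule Bochner_Integration.integrable_bound[OF i]) (auto intro!: AE_I2 simp: b)
  have "expectation (\<lambda>\<omega>. \<bar>Y \<omega> * Z \<omega>\<bar>) \<le> expectation (\<lambda>\<omega>. ((Y \<omega>)\<^sup>2 + (Z \<omega>)\<^sup>2) / 2)"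
    using * i by (intro integral_mono) (auto simp: b)
  also have "\<dots> = (expectation (\<lambda>\<omega>. (Y \<omega>)\<^sup>2) + expectation (\<lambda>\<omega>. (Z \<omega>)\<^sup>2)) / 2"
    using assms by simp
  finally show "expectation (\<lambda>\<omega>. \<bar>Y \<omega> * Z \<omega>\<bar>) \<le> \<dots>" .
qed

lemma expectation_square_add:
  fixes Y Z :: "'a \<Rightarrow> real"
  assumes "Y \<in> borel_measurable M" "Z \<in> borel_measurable M"
    and "integrable M (\<lambda>\<omega>. (Y \<omega>)\<^sup>2)" "integrable M (\<lambda>\<omega>. (Z \<omega>)\<^sup>2)"
  shows "expectation (\<lambda>\<omega>. (Y \<omega> + b * Z \<omega>)\<^sup>2) =
    expectation (\<lambda>\<omega>. (Y \<omega>)\<^sup>2) + 2 * b * expectation (\<lambda>\<omega>. Y \<omega> * Z \<omega>) + b\<^sup>2 * expectation (\<lambda>\<omega>. (Z \<omega>)\<^sup>2)"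
proof -
  have "(\<lambda>\<omega>. (Y \<omega> + b * Z \<omega>)\<^sup>2) = (\<lambda>\<omega>. (Y \<omega>)\<^sup>2 + 2 * b * (Y \<omega> * Z \<omega>) + b\<^sup>2 * (Z \<omega>)\<^sup>2)"
    by (auto simp: power2_eq_square algebra_simps)
  then show ?thesis
    using assms integrable_product_of_squares(1)[OF assms] by simp
qed

text \<open>Polarisation: \<^term>\<open>12 * a\<^sup>2 * b\<^sup>2 = (a + b)^4 + (a - b)^4 - 2 * a^4 - 2 * b^4\<close> for reals.\<close>

lemma isserlis:
  assumes "\<And>a b. \<exists>v. centered_normal M v (\<lambda>\<omega>. a * Y \<omega> + b * Z \<omega>)"
  shows "integrable M (\<lambda>\<omega>. (Y \<omega>)\<^sup>2 * (Z \<omega>)\<^sup>2)"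
    and "expectation (\<lambda>\<omega>. (Y \<omega>)\<^sup>2 * (Z \<omega>)\<^sup>2) =
      expectation (\<lambda>\<omega>. (Y \<omega>)\<^sup>2) * expectation (\<lambda>\<omega>. (Z \<omega>)\<^sup>2) + 2 * (expectation (\<lambda>\<omega>. Y \<omega> * Z \<omega>))\<^sup>2"
proof -
  obtain A where A: "centered_normal M A Y" using assms[of 1 0] by auto
  obtain B where B: "centered_normal M B Z" using assms[of 0 1] by auto
  obtain C where C: "centered_normal M C (\<lambda>\<omega>. Y \<omega> + 1 * Z \<omega>)" using assms[of 1 1] by auto
  obtain D where D: "centered_normal M D (\<lambda>\<omega>. Y \<omega> + (-1) * Z \<omega>)" using assms[of 1 "-1"] by auto
  note [simp] = centered_normal_moments[OF A] centered_normal_moments[OF B]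
    centered_normal_moments[OF C, simplified] centered_normal_moments[OF D, simplified]
  define c where "c = expectation (\<lambda>\<omega>. Y \<omega> * Z \<omega>)"
  have meas: "Y \<in> borel_measurable M" "Z \<in> borel_measurable M"
    using A B by (auto dest: centered_normal_measurable)
  have "C = A + 2 * c + B" "D = A - 2 * c + B"
    using expectation_square_add[OF meas, of 1] expectation_square_add[OF meas, of "-1"]
    by (auto simp: c_def)
  have eq: "(\<lambda>\<omega>. (Y \<omega>)\<^sup>2 * (Z \<omega>)\<^sup>2) =
      (\<lambda>\<omega>. ((Y \<omega> + Z \<omega>) ^ 4 + (Y \<omega> - Z \<omega>) ^ 4 - 2 * Y \<omega> ^ 4 - 2 * Z \<omega> ^ 4) / 12)"
    by (auto simp: power2_eq_square power4_eq_xxxx algebra_simps)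
  show "integrable M (\<lambda>\<omega>. (Y \<omega>)\<^sup>2 * (Z \<omega>)\<^sup>2)"
    unfolding eq by simp
  have "expectation (\<lambda>\<omega>. (Y \<omega>)\<^sup>2 * (Z \<omega>)\<^sup>2) = (3 * C\<^sup>2 + 3 * D\<^sup>2 - 6 * A\<^sup>2 - 6 * B\<^sup>2) / 12"
    unfolding eq by simp
  also have "\<dots> = A * B + 2 * c\<^sup>2"
    unfolding \<open>C = _\<close> \<open>D = _\<close> by (auto simp: power2_eq_square algebra_simps)
  finally show "expectation (\<lambda>\<omega>. (Y \<omega>)\<^sup>2 * (Z \<omega>)\<^sup>2) =
      expectation (\<lambda>\<omega>. (Y \<omega>)\<^sup>2) * expectation (\<lambda>\<omega>. (Z \<omega>)\<^sup>2) + 2 * (expectation (\<lambda>\<omega>. Y \<omega> * Z \<omega>))\<^sup>2"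
    by (simp add: c_def)
qed

end

section \<open>Filtering a continuous Gaussian process\<close>

lemma riemann_sums_tendsto:
  fixes f :: "real \<Rightarrow> real" and s :: real
  assumes "0 \<le> s" and cont: "continuous_on {0..s} f"
  shows "(\<lambda>n. \<Sum>i<Suc n. s / Suc n * f (i * s / Suc n)) \<longlonglongrightarrow> (LBINT r:{0..s}. f r)"
proof (cases "s = 0")
  case True
  then show ?thesis
    using set_borel_integral_eq_integral(2)[OF borel_integrable_atLeastAtMost'[OF cont]] by simp
next
  case False
  with \<open>0 \<le> s\<close> have s: "0 < s" by simp
  define F where "F x = integral {0..x} f" for x
  have F: "(F has_vector_derivative f x) (at x within {0..s})" if "x \<in> {0..s}" for x
    unfolding F_def using integral_has_vector_derivative[OF cont that] .
  have int_eq: "(LBINT r:{0..s}. f r) = F s"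
    unfolding F_def by (rule set_borel_integral_eq_integral(2)[OF borel_integrable_atLeastAtMost'[OF cont]])
  have F0: "F 0 = 0" by (simp add: F_def)
  show ?thesis
  proof (rule LIMSEQ_I)
    fix e :: real assume "0 < e"
    have "uniformly_continuous_on {0..s} f"
      using cont by (intro compact_uniformly_continuous) auto
    moreover have "0 < e / (2 * s)" using \<open>0 < e\<close> s by simp
    ultimately obtain d where d: "d > 0"
      "\<And>x y. x \<in> {0..s} \<Longrightarrow> y \<in> {0..s} \<Longrightarrow> \<bar>x - y\<bar> < d \<Longrightarrow> \<bar>f x - f y\<bar> < e / (2 * s)"
      unfolding uniformly_continuous_on_def dist_real_def by metis
    obtain N :: nat where N: "s / d < N" using reals_Archimedean2 by blast
    show "\<exists>no. \<forall>n\<ge>no. norm ((\<Sum>i<Suc n. s / Suc n * f (i * s / Suc n)) - (LBINT r:{0..s}. f r)) < e"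
    proof (intro exI[of _ N] allI impI)
      fix n assume "N \<le> n"
      define h where "h = s / Suc n"
      have h: "0 < h" using s by (simp add: h_def)
      have "s / d < Suc n" using N \<open>N \<le> n\<close> by linarith
      then have "h < d" using d(1) s by (simp add: h_def field_simps)
      \<comment> \<open>The mean value theorem for the antiderivative \<open>F\<close> replaces the
        integral over one cell by \<open>h * f x\<close> with \<open>x\<close> inside the cell. As
        \<open>h < d\<close>, uniform continuity bounds the error of the cell, and the cells of
        total length \<open>s\<close> add up to \<open>e / 2\<close>.\<close>
      have step: "\<bar>h * f (i * h) - (F (Suc i * h) - F (i * h))\<bar> \<le> h * (e / (2 * s))" if i: "i < Suc n" for i
      proof -
        have "Suc i * h \<le> Suc n * h"
          using i h by (intro mult_right_mono) auto
        then have le: "Suc i * h \<le> s" by (simp add: h_def)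
        have sub: "{i * h..Suc i * h} \<subseteq> {0..s}" using le h by auto
        have "\<exists>x\<in>{i * h<..<Suc i * h}. F (Suc i * h) - F (i * h) = (\<lambda>y. y *\<^sub>R f x) (Suc i * h - i * h)"
        proof (rule mvt_simple)
          show "real i * h < real (Suc i) * h" using h by simp
          fix x assume "real i * h \<le> x" "x \<le> real (Suc i) * h"
          then have "x \<in> {i * h..Suc i * h}" by simp
          then have "(F has_vector_derivative f x) (at x within {i * h..Suc i * h})"
            using F sub by (meson has_vector_derivative_within_subset subsetD)
          then show "(F has_derivative (\<lambda>y. y *\<^sub>R f x)) (at x within {i * h..Suc i * h})"
            by (simp add: has_vector_derivative_def)
        qed
        then obtain x where x: "i * h < x" "x < Suc i * h" "F (Suc i * h) - F (i * h) = h * f x"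
          by (auto simp: algebra_simps)
        have "Suc i * h = i * h + h" by (simp add: algebra_simps)
        then have "\<bar>f (i * h) - f x\<bar> \<le> e / (2 * s)"
          using x le h \<open>h < d\<close> mult_nonneg_nonneg[of "real i" h]
          by (intro less_imp_le d(2)) (auto simp del: zero_le_mult_iff mult_nonneg_nonneg)
        then have "h * \<bar>f (i * h) - f x\<bar> \<le> h * (e / (2 * s))"
          using h by (intro mult_left_mono) auto
        moreover have "\<bar>h * f (i * h) - h * f x\<bar> = h * \<bar>f (i * h) - f x\<bar>"
          using h by (simp add: abs_mult flip: right_diff_distrib)
        ultimately show ?thesis unfolding x(3) by linarith
      qed
      have tele: "(\<Sum>i<Suc n. F (Suc i * h) - F (i * h)) = F s"
        using sum_lessThan_telescope[of "\<lambda>i. F (i * h)" "Suc n"] F0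
        by (simp add: h_def del: sum.lessThan_Suc)
      have "(\<Sum>i<Suc n. s / Suc n * f (i * s / Suc n)) - (LBINT r:{0..s}. f r)
          = (\<Sum>i<Suc n. h * f (i * h) - (F (Suc i * h) - F (i * h)))"
        unfolding int_eq sum_subtractf tele[symmetric] by (simp add: h_def sum_subtractf del: sum.lessThan_Suc)
      also have "\<bar>\<dots>\<bar> \<le> (\<Sum>i<Suc n. h * (e / (2 * s)))"
        by (rule order_trans[OF sum_abs]) (intro sum_mono step, simp)
      also have "\<dots> = (Suc n * h) * (e / (2 * s))" by (simp only: sum_constant card_lessThan mult.assoc)
      also have "Suc n * h = s" by (simp add: h_def)
      also have "s * (e / (2 * s)) = e / 2" using s by simp
      also have "\<dots> < e" using \<open>0 < e\<close> by simp
      finally show "norm ((\<Sum>i<Suc n. s / Suc n * f (i * s / Suc n)) - (LBINT r:{0..s}. f r)) < e"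
        by simp
    qed
  qed
qed

text \<open>Freezing the time at a grid point of mesh \<open>1 / Suc n\<close> leaves countably many
  measurable pieces, and continuity of the paths makes these approximations converge pointwise.
  Clamping by \<open>max 0\<close> gives a function on the whole line although the process is only
  controlled at nonnegative times.\<close>

lemma borel_measurable_continuous_process:
  fixes Y :: "real \<Rightarrow> 'a \<Rightarrow> real"
  assumes meas: "\<And>t. 0 \<le> t \<Longrightarrow> Y t \<in> borel_measurable M"
    and cont: "\<And>\<omega>. \<omega> \<in> space M \<Longrightarrow> continuous_on {0..} (\<lambda>t. Y t \<omega>)"
  shows "(\<lambda>(t, \<omega>). Y (max 0 t) \<omega>) \<in> borel_measurable (borel \<Otimes>\<^sub>M M)"
proof -
  have m: "(\<lambda>p. Y (max 0 (real_of_int i / real (Suc n))) (snd p)) \<in> borel_measurable (borel \<Otimes>\<^sub>M M)"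
    for n :: nat and i :: int
    by (rule measurable_compose[OF measurable_snd meas]) simp
  have m': "(\<lambda>p. Y (max 0 (real_of_int \<lfloor>Suc n * fst p\<rfloor> / real (Suc n))) (snd p)) \<in> borel_measurable ((borel :: real measure) \<Otimes>\<^sub>M M)"
    for n :: nat
    by (rule measurable_compose_countable[OF m]) measurable
  have fl: "(\<lambda>n. real_of_int \<lfloor>Suc n * t\<rfloor> / real (Suc n)) \<longlonglongrightarrow> t" for t :: real
  proof (rule tendsto_sandwich)
    show "(\<lambda>n. t - 1 / real (Suc n)) \<longlonglongrightarrow> t"
      using tendsto_diff[OF tendsto_const[of t] LIMSEQ_inverse_real_of_nat]
      by (simp add: inverse_eq_divide)
    show "\<forall>\<^sub>F n in sequentially. t - 1 / real (Suc n) \<le> real_of_int \<lfloor>Suc n * t\<rfloor> / real (Suc n)"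
    proof (rule always_eventually, rule allI)
      fix n :: nat
      have "t * real (Suc n) - 1 \<le> real_of_int \<lfloor>Suc n * t\<rfloor>" 
        using real_of_int_floor_gt_diff_one[of "Suc n * t"] by (simp add: mult.commute less_imp_le)
      then show "t - 1 / real (Suc n) \<le> real_of_int \<lfloor>Suc n * t\<rfloor> / real (Suc n)"
        by (simp add: pos_le_divide_eq left_diff_distrib)
    qed
    show "\<forall>\<^sub>F n in sequentially. real_of_int \<lfloor>Suc n * t\<rfloor> / real (Suc n) \<le> t"
    proof (rule always_eventually, rule allI)
      fix n :: nat
      have "real_of_int \<lfloor>Suc n * t\<rfloor> \<le> t * real (Suc n)"
        using of_int_floor_le[of "Suc n * t"] by (simp add: mult.commute)
      then show "real_of_int \<lfloor>Suc n * t\<rfloor> / real (Suc n) \<le> t"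
        by (simp add: pos_divide_le_eq)
    qed
  qed simp
  have "(\<lambda>p. Y (max 0 (fst p)) (snd p)) \<in> borel_measurable (borel \<Otimes>\<^sub>M M)"
  proof (rule borel_measurable_LIMSEQ_real[OF _ m'])
    fix p :: "real \<times> 'a" assume "p \<in> space (borel \<Otimes>\<^sub>M M)"
    then have "snd p \<in> space M" by (auto simp: space_pair_measure)
    show "(\<lambda>n. Y (max 0 (real_of_int \<lfloor>Suc n * fst p\<rfloor> / real (Suc n))) (snd p)) \<longlonglongrightarrow> Y (max 0 (fst p)) (snd p)"
      by (rule continuous_on_tendsto_compose[OF cont[OF \<open>snd p \<in> space M\<close>]])
        (auto intro!: tendsto_intros fl simp del: of_nat_Suc)
  qed
  then show ?thesis by (simp add: case_prod_beta')
qed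

text \<open>Tonelli's criterion in the form behind the exchanges of Bochner integrals below: an
  integrable majorant of the inner L1 norms is enough.\<close>

lemma integrable_pair_bound:
  fixes F :: "_ \<Rightarrow> real"
  assumes "sigma_finite_measure N" "sigma_finite_measure M"
    and F[measurable]: "F \<in> borel_measurable (N \<Otimes>\<^sub>M M)"
    and b: "integrable N b"
    and int: "\<And>x. x \<in> space N \<Longrightarrow> integrable M (\<lambda>y. F (x, y))"
    and le: "\<And>x. x \<in> space N \<Longrightarrow> (\<integral>y. \<bar>F (x, y)\<bar> \<partial>M) \<le> b x"
  shows "integrable (N \<Otimes>\<^sub>M M) F"
proof -
  interpret N: sigma_finite_measure N by fact
  interpret M: sigma_finite_measure M by fact
  interpret pair_sigma_finite N M ..
  show ?thesis
  proof (rule Fubini_integrable[OF F])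
    show "integrable N (\<lambda>x. \<integral>y. norm (F (x, y)) \<partial>M)"
    proof (rule Bochner_Integration.integrable_bound[OF b])
      show "AE x in N. norm (\<integral>y. norm (F (x, y)) \<partial>M) \<le> norm (b x)"
      proof (rule AE_I2)
        fix x assume "x \<in> space N"
        have "0 \<le> (\<integral>y. \<bar>F (x, y)\<bar> \<partial>M)" by (rule integral_nonneg_AE) simp
        then show "norm (\<integral>y. norm (F (x, y)) \<partial>M) \<le> norm (b x)"
          using le[OF \<open>x \<in> space N\<close>] by simp
      qed
    qed measurable
  qed (use int in auto)
qed

text \<open>The solution at time \<open>t\<close> of \<open>dx = - \<theta> x dt + df\<close>,
  started from 0 when \<open>f 0 = 0\<close>, after integration by parts. It is an operator on
  arbitrary functions because it acts on paths, on each argument of a covariance and on step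
  functions.\<close>

definition exp_filter :: "real \<Rightarrow> real \<Rightarrow> (real \<Rightarrow> real) \<Rightarrow> real" where
  "exp_filter \<theta> t f = f t - \<theta> * (\<integral>r. indicator {0..t} r * (exp (- \<theta> * (t - r)) * f r) \<partial>lborel)"

lemma exp_filter_cong:
  assumes "\<And>r. 0 \<le> r \<Longrightarrow> r \<le> t \<Longrightarrow> f r = g r" "0 \<le> t"
  shows "exp_filter \<theta> t f = exp_filter \<theta> t g"
  unfolding exp_filter_def using assms
  by (auto intro!: Bochner_Integration.integral_cong simp: indicator_def)

lemma exp_filter_eq_LBINT:
  "0 \<le> t \<Longrightarrow> exp_filter \<theta> t f = f t - \<theta> * (LBINT s=0..t. exp (- \<theta> * (t - s)) * f s)"
  using interval_integral_Icc[of 0 t "\<lambda>s. exp (- \<theta> * (t - s)) * f s"]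
  by (simp add: exp_filter_def set_lebesgue_integral_def zero_ereal_def)

section \<open>The filtered process: Gaussianity and covariance\<close>

locale continuous_gaussian_process = prob_space M for M :: "'a measure" +
  fixes \<xi> :: "real \<Rightarrow> 'a \<Rightarrow> real" and R :: "real \<Rightarrow> real \<Rightarrow> real" and \<theta> :: real
  assumes gaussian: "centered_gaussian_process M \<xi> R"
    and continuous_paths: "\<And>\<omega>. \<omega> \<in> space M \<Longrightarrow> continuous_on {0..} (\<lambda>t. \<xi> t \<omega>)"
    and R_sym: "\<And>s t. 0 \<le> s \<Longrightarrow> 0 \<le> t \<Longrightarrow> R s t = R t s"
    and R_bounded: "\<And>T. \<exists>B. \<forall>t\<in>{0..T}. R t t \<le> B"
begin

text \<open>Frozen at its initial value for negative times, so that joint measurability holds on the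
  whole line, as integrals against \<open>lborel\<close> require.\<close>

definition noise :: "real \<Rightarrow> 'a \<Rightarrow> real" where
  "noise t \<omega> = \<xi> (max 0 t) \<omega>"

definition ou :: "real \<Rightarrow> 'a \<Rightarrow> real" where
  "ou t \<omega> = exp_filter \<theta> t (\<lambda>s. noise s \<omega>)"

lemma noise_measurable_pair: "(\<lambda>(t, \<omega>). noise t \<omega>) \<in> borel_measurable (borel \<Otimes>\<^sub>M M)"
  unfolding noise_def using gaussian continuous_paths
  by (intro borel_measurable_continuous_process) (auto simp: centered_gaussian_process_def)

lemma noise_measurable_compose [measurable (raw)]:
  assumes "f \<in> borel_measurable N" "g \<in> N \<rightarrow>\<^sub>M M"
  shows "(\<lambda>x. noise (f x) (g x)) \<in> borel_measurable N"
  using measurable_compose[OF measurable_Pair[OF assms] noise_measurable_pair] by simp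

lemma ou_measurable_compose [measurable (raw)]:
  assumes [measurable]: "f \<in> borel_measurable N" "g \<in> N \<rightarrow>\<^sub>M M"
  shows "(\<lambda>x. ou (f x) (g x)) \<in> borel_measurable N"
  unfolding ou_def exp_filter_def indicator_def atLeastAtMost_iff by measurable

lemma centered_normal_sum:
  assumes "length cs = length ts" "\<forall>t\<in>set ts. 0 \<le> t"
  shows "centered_normal M (\<Sum>i<length ts. \<Sum>j<length ts. cs!i * cs!j * R (ts!i) (ts!j))
    (\<lambda>\<omega>. \<Sum>i<length ts. cs!i * \<xi> (ts!i) \<omega>)"
  unfolding centered_normal_def using gaussian assms
  by (auto intro!: borel_measurable_sum borel_measurable_times simp: centered_gaussian_process_def)

lemma centered_normal_sum_list:
  assumes "\<And>c t. (c, t) \<in> set ps \<Longrightarrow> 0 \<le> t"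
  shows "\<exists>v. centered_normal M v (\<lambda>\<omega>. sum_list (map (\<lambda>(c, t). c * \<xi> t \<omega>) ps))"
proof -
  have eq: "(\<Sum>i<length (map snd ps). map fst ps ! i * \<xi> (map snd ps ! i) \<omega>) = sum_list (map (\<lambda>(c, t). c * \<xi> t \<omega>) ps)" for \<omega>
    by (simp add: sum_list_sum_nth case_prod_beta' atLeast0LessThan)
  have "\<forall>t\<in>set (map snd ps). 0 \<le> t" using assms by auto
  from centered_normal_sum[OF _ this, of "map fst ps"] show ?thesis
    unfolding eq by auto
qed

text \<open>The process is specified by the variances of its linear combinations; the covariance is
  recovered from the variance of \<open>noise s + noise t\<close>, which is where the symmetry of
  \<open>R\<close> enters.\<close>

lemma noise_moments:
  assumes "0 \<le> s" "0 \<le> t"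
  shows "integrable M (\<lambda>\<omega>. (noise t \<omega>)\<^sup>2)" and "expectation (\<lambda>\<omega>. noise s \<omega> * noise t \<omega>) = R s t"
proof -
  have 1: "centered_normal M (R t t) (noise t)" if "0 \<le> t" for t
    using centered_normal_sum[of "[1]" "[t]"] that by (simp add: noise_def[abs_def])
  show sq: "integrable M (\<lambda>\<omega>. (noise t \<omega>)\<^sup>2)"
    using centered_normal_moments(1)[OF 1] \<open>0 \<le> t\<close> .
  have sq': "integrable M (\<lambda>\<omega>. (noise s \<omega>)\<^sup>2)"
    using centered_normal_moments(1)[OF 1] \<open>0 \<le> s\<close> .
  have "centered_normal M (R s s + 2 * R s t + R t t) (\<lambda>\<omega>. noise s \<omega> + 1 * noise t \<omega>)"
    using centered_normal_sum[of "[1, 1]" "[s, t]"] assms R_sym[of s t]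
    by (simp add: noise_def[abs_def] lessThan_Suc algebra_simps)
  from centered_normal_moments(2)[OF this]
  show "expectation (\<lambda>\<omega>. noise s \<omega> * noise t \<omega>) = R s t"
    using centered_normal_moments(2)[OF 1] assms
    by (subst (asm) expectation_square_add) (auto intro: sq sq')
qed

lemma ou_riemann:
  fixes t :: real
  assumes "0 \<le> t" "\<omega> \<in> space M"
  shows "(\<lambda>n. \<xi> t \<omega> + (\<Sum>i<Suc n. (- \<theta> * (t / Suc n) * exp (- \<theta> * (t - i * t / Suc n))) * \<xi> (i * t / Suc n) \<omega>))
    \<longlonglongrightarrow> ou t \<omega>"
proof -
  have "continuous_on {0..t} (\<lambda>r. exp (- \<theta> * (t - r)) * \<xi> r \<omega>)"
    by (intro continuous_intros continuous_on_subset[OF continuous_paths[OF assms(2)]]) auto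
  from riemann_sums_tendsto[OF assms(1) this]
  have "(\<lambda>n. \<xi> t \<omega> - \<theta> * (\<Sum>i<Suc n. t / Suc n * (exp (- \<theta> * (t - i * t / Suc n)) * \<xi> (i * t / Suc n) \<omega>)))
     \<longlonglongrightarrow> \<xi> t \<omega> - \<theta> * (LBINT r:{0..t}. exp (- \<theta> * (t - r)) * \<xi> r \<omega>)"
    by (intro tendsto_intros)
  moreover have "\<xi> t \<omega> - \<theta> * (LBINT r:{0..t}. exp (- \<theta> * (t - r)) * \<xi> r \<omega>) = ou t \<omega>"
    using assms by (auto simp: ou_def exp_filter_def set_lebesgue_integral_def noise_def indicator_def intro!: Bochner_Integration.integral_cong)
  ultimately show ?thesis
    by (simp add: sum_distrib_left sum_negf mult.assoc del: sum.lessThan_Suc)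
qed

lemma ou_centered_normal:
  assumes "0 \<le> s" "0 \<le> t"
  shows "\<exists>v. centered_normal M v (\<lambda>\<omega>. a * ou s \<omega> + b * ou t \<omega>)"
proof -
  define cf where "cf t n i = - \<theta> * (t / Suc n) * exp (- \<theta> * (t - real i * t / Suc n))" for t :: real and n i :: nat
  \<comment> \<open>Pairs of coefficient and time for the \<open>n\<close>-th approximation of
    \<open>c * ou t\<close>: the head is the value at \<open>t\<close> itself, the tail the Riemann
    nodes. Appending the lists for \<open>s\<close> and \<open>t\<close> keeps everything one finite
    linear combination.\<close>
  define ps where "ps c t n = (c, t) # map (\<lambda>i. (c * cf t n i, real i * t / Suc n)) [0..<Suc n]" for c t :: real and n :: nat
  have ps: "sum_list (map (\<lambda>(c, t). c * \<xi> t \<omega>) (ps c t n)) =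
     c * (\<xi> t \<omega> + (\<Sum>i<Suc n. cf t n i * \<xi> (i * t / Suc n) \<omega>))" for c t :: real and n \<omega>
    by (simp add: ps_def comp_def interv_sum_list_conv_sum_set_nat atLeast0LessThan distrib_left sum_distrib_left mult.assoc
          del: upt_Suc sum.lessThan_Suc)
  have "\<exists>v. centered_normal M v (\<lambda>\<omega>. sum_list (map (\<lambda>(c, t). c * \<xi> t \<omega>) (ps a s n @ ps b t n)))" for n
    using assms by (intro centered_normal_sum_list) (auto simp: ps_def)
  then obtain v where v: "\<And>n. centered_normal M (v n) (\<lambda>\<omega>. sum_list (map (\<lambda>(c, t). c * \<xi> t \<omega>) (ps a s n @ ps b t n)))"
    by metis
  show ?thesis
  proof (rule centered_normal_limit[OF v])
    fix \<omega> assume "\<omega> \<in> space M"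
    then show "(\<lambda>n. sum_list (map (\<lambda>(c, t). c * \<xi> t \<omega>) (ps a s n @ ps b t n))) \<longlonglongrightarrow> a * ou s \<omega> + b * ou t \<omega>"
      unfolding map_append sum_list_append ps unfolding cf_def
      using assms by (intro tendsto_intros ou_riemann)
  qed
qed

lemma ou_square_integrable: "0 \<le> t \<Longrightarrow> integrable M (\<lambda>\<omega>. (ou t \<omega>)\<^sup>2)"
  using ou_centered_normal[of t t 1 0] by (auto intro: centered_normal_moments(1))

text \<open>Fubini moves the expectation inside the filter. The majorant comes from
  \<open>\<bar>Z * Y\<bar> \<le> (Z\<^sup>2 + Y\<^sup>2) / 2\<close> and the local bound on the
  diagonal of \<open>R\<close>.\<close>

lemma expectation_mult_ou:
  assumes [measurable]: "Z \<in> borel_measurable M" and Z: "integrable M (\<lambda>\<omega>. (Z \<omega>)\<^sup>2)" and "0 \<le> t"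
  shows "expectation (\<lambda>\<omega>. Z \<omega> * ou t \<omega>) = exp_filter \<theta> t (\<lambda>r. expectation (\<lambda>\<omega>. Z \<omega> * noise r \<omega>))"
proof -
  obtain B where B: "\<And>r. 0 \<le> r \<Longrightarrow> r \<le> t \<Longrightarrow> R r r \<le> B"
    using R_bounded[of t] by (metis atLeastAtMost_iff)
  \<comment> \<open>Bounds the exponential weight on \<open>[0, t]\<close> for either sign of
    \<theta>.\<close>
  define c where "c = exp (\<bar>\<theta>\<bar> * t)"
  define F where "F = (\<lambda>(r, \<omega>). indicator {0..t} r * (exp (- \<theta> * (t - r)) * (Z \<omega> * noise r \<omega>)))"
  interpret pair_sigma_finite lborel M ..
  have intZ: "integrable M (\<lambda>\<omega>. Z \<omega> * noise r \<omega>)" if "0 \<le> r" for r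
    using that by (intro integrable_product_of_squares Z noise_moments(1)) auto
  have [measurable]: "F \<in> borel_measurable (lborel \<Otimes>\<^sub>M M)"
    unfolding F_def case_prod_beta' by measurable
  have F: "integrable (lborel \<Otimes>\<^sub>M M) F"
  proof (rule integrable_pair_bound[where b="\<lambda>r. indicator {0..t} r * (c * ((expectation (\<lambda>\<omega>. (Z \<omega>)\<^sup>2) + B) / 2))"])
    show "integrable lborel (\<lambda>r. indicator {0..t} r * (c * ((expectation (\<lambda>\<omega>. (Z \<omega>)\<^sup>2) + B) / 2)))"
      by (intro integrable_mult_left integrable_real_indicator) (auto simp: emeasure_lborel_Icc_eq)
    fix r :: real
    show "integrable M (\<lambda>\<omega>. F (r, \<omega>))"
      using intZ[of r] by (cases "0 \<le> r") (auto simp: F_def)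
    show "expectation (\<lambda>\<omega>. \<bar>F (r, \<omega>)\<bar>) \<le> indicator {0..t} r * (c * ((expectation (\<lambda>\<omega>. (Z \<omega>)\<^sup>2) + B) / 2))"
    proof (cases "0 \<le> r \<and> r \<le> t")
      case True
      have "- \<theta> * (t - r) \<le> \<bar>\<theta>\<bar> * (t - r)"
        using True by (intro mult_right_mono) auto
      also have "\<dots> \<le> \<bar>\<theta>\<bar> * t" using True by (intro mult_left_mono) auto
      finally have e: "exp (- \<theta> * (t - r)) \<le> c" by (simp add: c_def)
      have "expectation (\<lambda>\<omega>. \<bar>F (r, \<omega>)\<bar>) = exp (- \<theta> * (t - r)) * expectation (\<lambda>\<omega>. \<bar>Z \<omega> * noise r \<omega>\<bar>)"
        using True by (simp add: F_def abs_mult)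
      also have "\<dots> \<le> c * ((expectation (\<lambda>\<omega>. (Z \<omega>)\<^sup>2) + expectation (\<lambda>\<omega>. (noise r \<omega>)\<^sup>2)) / 2)"
        using True by (intro mult_mono e integrable_product_of_squares Z noise_moments(1)) (auto simp: c_def)
      also have "expectation (\<lambda>\<omega>. (noise r \<omega>)\<^sup>2) = R r r"
        using noise_moments(2)[of r r] True by (simp add: power2_eq_square)
      also have "c * ((expectation (\<lambda>\<omega>. (Z \<omega>)\<^sup>2) + R r r) / 2) \<le> c * ((expectation (\<lambda>\<omega>. (Z \<omega>)\<^sup>2) + B) / 2)"
        using B True by (intro mult_left_mono) (auto simp: c_def)
      finally show ?thesis using True by simp
    qed (auto simp: F_def)
  qed (auto intro: sigma_finite_lborel prob_space_imp_sigma_finite prob_space_axioms)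
  have F': "integrable (lborel \<Otimes>\<^sub>M M) (case_prod (\<lambda>r \<omega>. F (r, \<omega>)))"
    using F by simp
  define J where "J \<omega> = (\<integral>r. indicator {0..t} r * (exp (- \<theta> * (t - r)) * noise r \<omega>) \<partial>lborel)" for \<omega>
  have J: "(\<integral>r. F (r, \<omega>) \<partial>lborel) = Z \<omega> * J \<omega>" for \<omega>
    unfolding J_def by (subst integral_mult_right_zero[symmetric]) (simp add: F_def ac_simps)
  have iJ: "integrable M (\<lambda>\<omega>. Z \<omega> * J \<omega>)"
    using integrable_snd[OF F'] unfolding J .
  have "expectation (\<lambda>\<omega>. Z \<omega> * J \<omega>) = (\<integral>r. expectation (\<lambda>\<omega>. F (r, \<omega>)) \<partial>lborel)"
    using Fubini_integral[OF F'] unfolding J .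
  also have "\<dots> = (\<integral>r. indicator {0..t} r * (exp (- \<theta> * (t - r)) * expectation (\<lambda>\<omega>. Z \<omega> * noise r \<omega>)) \<partial>lborel)"
    by (simp add: F_def)
  finally have EJ: "expectation (\<lambda>\<omega>. Z \<omega> * J \<omega>) = \<dots>" .
  have "(\<lambda>\<omega>. Z \<omega> * ou t \<omega>) = (\<lambda>\<omega>. Z \<omega> * noise t \<omega> - \<theta> * (Z \<omega> * J \<omega>))"
    by (auto simp: ou_def exp_filter_def J_def algebra_simps)
  then have "expectation (\<lambda>\<omega>. Z \<omega> * ou t \<omega>) = expectation (\<lambda>\<omega>. Z \<omega> * noise t \<omega>) - \<theta> * expectation (\<lambda>\<omega>. Z \<omega> * J \<omega>)"
    using iJ intZ[OF \<open>0 \<le> t\<close>] by simp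
  then show ?thesis unfolding EJ exp_filter_def .
qed

text \<open>Two applications of \<open>expectation_mult_ou\<close>: with \<open>Z = noise r\<close>
  for the argument \<open>s\<close>, then with \<open>Z = ou s\<close> for the argument
  \<open>t\<close>.\<close>

lemma ou_cov:
  assumes "0 \<le> s" "0 \<le> t"
  shows "expectation (\<lambda>\<omega>. ou s \<omega> * ou t \<omega>) = exp_filter \<theta> t (\<lambda>r. exp_filter \<theta> s (\<lambda>q. R q r))"
proof -
  have "expectation (\<lambda>\<omega>. ou s \<omega> * noise r \<omega>) = exp_filter \<theta> s (\<lambda>q. R q r)" if "0 \<le> r" for r
  proof -
    have "expectation (\<lambda>\<omega>. ou s \<omega> * noise r \<omega>) = exp_filter \<theta> s (\<lambda>q. expectation (\<lambda>\<omega>. noise r \<omega> * noise q \<omega>))"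
      using expectation_mult_ou[of "noise r" s] noise_moments(1)[of r r] that assms by (simp add: mult.commute)
    also have "\<dots> = exp_filter \<theta> s (\<lambda>q. R q r)"
      using that assms by (intro exp_filter_cong) (auto simp: noise_moments R_sym)
    finally show ?thesis .
  qed
  moreover have "expectation (\<lambda>\<omega>. ou s \<omega> * ou t \<omega>) = exp_filter \<theta> t (\<lambda>r. expectation (\<lambda>\<omega>. ou s \<omega> * noise r \<omega>))"
    using assms by (intro expectation_mult_ou ou_square_integrable) auto
  ultimately show ?thesis
    using assms by (auto intro!: exp_filter_cong)
qed

end

section \<open>Covariances given by a planar measure\<close>

lemma exp_integral_right:
  fixes a b \<theta> :: real
  assumes "a \<le> b" "0 < \<theta>"
  shows "integrable lborel (\<lambda>r. indicator {a..b} r * exp (- \<theta> * (b - r)))"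
    and "(\<integral>r. indicator {a..b} r * exp (- \<theta> * (b - r)) \<partial>lborel) = (1 - exp (- \<theta> * (b - a))) / \<theta>"
proof -
  show "integrable lborel (\<lambda>r. indicator {a..b} r * exp (- \<theta> * (b - r)))"
    using borel_integrable_atLeastAtMost[of a b "\<lambda>r. exp (- \<theta> * (b - r))"]
    by (simp add: mult.commute)
  have "(\<integral>r. exp (- \<theta> * (b - r)) * indicator {a..b} r \<partial>lborel)
      = exp (- \<theta> * (b - b)) / \<theta> - exp (- \<theta> * (b - a)) / \<theta>"
    using assms by (intro integral_FTC_Icc_real) (auto intro!: derivative_eq_intros continuous_intros)
  then show "(\<integral>r. indicator {a..b} r * exp (- \<theta> * (b - r)) \<partial>lborel) = (1 - exp (- \<theta> * (b - a))) / \<theta>"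
    by (simp add: mult.commute diff_divide_distrib)
qed

lemma exp_integral_left:
  fixes a b \<theta> :: real
  assumes "a \<le> b" "0 < \<theta>"
  shows "integrable lborel (\<lambda>r. indicator {a..b} r * exp (- \<theta> * (r - a)))"
    and "(\<integral>r. indicator {a..b} r * exp (- \<theta> * (r - a)) \<partial>lborel) = (1 - exp (- \<theta> * (b - a))) / \<theta>"
proof -
  show "integrable lborel (\<lambda>r. indicator {a..b} r * exp (- \<theta> * (r - a)))"
    using borel_integrable_atLeastAtMost[of a b "\<lambda>r. exp (- \<theta> * (r - a))"]
    by (simp add: mult.commute)
  have "(\<integral>r. exp (- \<theta> * (r - a)) * indicator {a..b} r \<partial>lborel)
      = - exp (- \<theta> * (b - a)) / \<theta> - - exp (- \<theta> * (a - a)) / \<theta>"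
    using assms by (intro integral_FTC_Icc_real) (auto intro!: derivative_eq_intros continuous_intros)
  then show "(\<integral>r. indicator {a..b} r * exp (- \<theta> * (r - a)) \<partial>lborel) = (1 - exp (- \<theta> * (b - a))) / \<theta>"
    by (simp add: mult.commute diff_divide_distrib)
qed

definition exp_kernel :: "real \<Rightarrow> real \<Rightarrow> real \<Rightarrow> real" where
  "exp_kernel \<theta> t u = (if u \<le> t then exp (- \<theta> * (t - u)) else 0)"

lemma exp_kernel_measurable [measurable (raw)]:
  assumes [measurable]: "f \<in> borel_measurable N" "g \<in> borel_measurable N"
  shows "(\<lambda>x. exp_kernel \<theta> (f x) (g x)) \<in> borel_measurable N"
  unfolding exp_kernel_def by measurable

lemma exp_kernel_nonneg [simp]: "0 \<le> exp_kernel \<theta> t u"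
  by (simp add: exp_kernel_def)

lemma exp_kernel_le_1: "0 < \<theta> \<Longrightarrow> exp_kernel \<theta> t u \<le> 1"
  by (simp add: exp_kernel_def)

text \<open>Fubini reduces the claim to a step function with jump at \<open>\<phi> p\<close>: one
  minus \<theta> times the integral of \<open>exp (- \<theta> * (s - r))\<close> over
  \<open>[\<phi> p, s]\<close> equals \<open>exp (- \<theta> * (s - \<phi> p))\<close>.
  Nonnegativity of \<open>\<phi>\<close> keeps this interval inside the range of the filter. The
  weight \<open>h\<close> carries the factor belonging to the other argument.\<close>

lemma exp_filter_integral:
  fixes \<phi> h :: "'b \<Rightarrow> real"
  assumes "finite_measure \<mu>" "0 < \<theta>" "0 \<le> s"
    and [measurable]: "\<phi> \<in> borel_measurable \<mu>" "h \<in> borel_measurable \<mu>"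
    and h: "\<And>p. \<bar>h p\<bar> \<le> 1" and \<phi>: "AE p in \<mu>. 0 \<le> \<phi> p"
  shows "exp_filter \<theta> s (\<lambda>r. \<integral>p. (if \<phi> p \<le> r then h p else 0) \<partial>\<mu>) = (\<integral>p. exp_kernel \<theta> s (\<phi> p) * h p \<partial>\<mu>)"
proof -
  interpret finite_measure \<mu> by fact
  interpret pair_sigma_finite lborel \<mu> ..
  define G where "G p r = (if \<phi> p \<le> r then h p else 0)" for p r
  have [measurable (raw)]: "(\<lambda>x. G (f x) (g x)) \<in> borel_measurable N"
    if [measurable]: "f \<in> N \<rightarrow>\<^sub>M \<mu>" "g \<in> borel_measurable N" for f g and N :: "'c measure"
    unfolding G_def by measurable
  have G1: "\<bar>G p r\<bar> \<le> 1" for p r using h by (simp add: G_def)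
  have Gi: "integrable \<mu> (\<lambda>p. G p r)" for r
    by (rule integrable_const_bound[where B=1]) (simp_all add: G1)
  define F where "F r p = indicator {0..s} r * (exp (- \<theta> * (s - r)) * G p r)" for r p
  have [measurable]: "(\<lambda>(r, p). F r p) \<in> borel_measurable (lborel \<Otimes>\<^sub>M \<mu>)"
    unfolding F_def G_def by measurable
  have F: "integrable (lborel \<Otimes>\<^sub>M \<mu>) (\<lambda>(r, p). F r p)"
  proof (rule integrable_pair_bound[where b="\<lambda>r. indicator {0..s} r * measure \<mu> (space \<mu>)"])
    fix r :: real
    show "integrable \<mu> (\<lambda>p. case (r, p) of (r, p) \<Rightarrow> F r p)"
      using Gi by (simp add: F_def)
    have "(\<integral>p. \<bar>F r p\<bar> \<partial>\<mu>) \<le> (\<integral>p. indicator {0..s} r \<partial>\<mu>)"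
    proof (rule integral_mono)
      show "integrable \<mu> (\<lambda>p. \<bar>F r p\<bar>)" using Gi by (simp add: F_def)
      have "\<bar>F r p\<bar> \<le> indicator {0..s} r * (1 * 1)" for p
        unfolding F_def abs_mult using G1 \<open>0 < \<theta>\<close>
        by (cases "r \<in> {0..s}") (auto intro!: mult_le_one)
      then show "\<bar>F r p\<bar> \<le> indicator {0..s} r" for p by simp
    qed simp
    then show "(\<integral>p. \<bar>case (r, p) of (r, p) \<Rightarrow> F r p\<bar> \<partial>\<mu>) \<le> indicator {0..s} r * measure \<mu> (space \<mu>)"
      by (simp add: mult.commute)
  qed (auto simp: emeasure_lborel_Icc_eq intro: sigma_finite_lborel sigma_finite_measure)
  have inner: "(\<integral>r. F r p \<partial>lborel) = h p * (if \<phi> p \<le> s then (1 - exp (- \<theta> * (s - \<phi> p))) / \<theta> else 0)" if "0 \<le> \<phi> p" for p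
  proof -
    have "(\<integral>r. F r p \<partial>lborel) = (\<integral>r. h p * (indicator {\<phi> p..s} r * exp (- \<theta> * (s - r))) \<partial>lborel)"
      using that by (intro Bochner_Integration.integral_cong) (auto simp: F_def G_def indicator_def)
    also have "\<dots> = h p * (\<integral>r. indicator {\<phi> p..s} r * exp (- \<theta> * (s - r)) \<partial>lborel)"
      by simp
    also have "(\<integral>r. indicator {\<phi> p..s} r * exp (- \<theta> * (s - r)) \<partial>lborel) = (if \<phi> p \<le> s then (1 - exp (- \<theta> * (s - \<phi> p))) / \<theta> else 0)"
      using exp_integral_right(2)[of "\<phi> p" s \<theta>] \<open>0 < \<theta>\<close> by simp
    finally show ?thesis .
  qed
  have int: "integrable \<mu> (\<lambda>p. \<integral>r. F r p \<partial>lborel)"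
    using integrable_snd[OF F] .
  have "exp_filter \<theta> s (\<lambda>r. \<integral>p. G p r \<partial>\<mu>) = (\<integral>p. G p s \<partial>\<mu>) - \<theta> * (\<integral>r. (\<integral>p. F r p \<partial>\<mu>) \<partial>lborel)"
    by (simp add: exp_filter_def F_def)
  also have "(\<integral>r. (\<integral>p. F r p \<partial>\<mu>) \<partial>lborel) = (\<integral>p. (\<integral>r. F r p \<partial>lborel) \<partial>\<mu>)"
    using Fubini_integral[OF F] by simp
  also have "(\<integral>p. G p s \<partial>\<mu>) - \<theta> * \<dots> = (\<integral>p. G p s - \<theta> * (\<integral>r. F r p \<partial>lborel) \<partial>\<mu>)"
    using Gi int by simp
  also have "\<dots> = (\<integral>p. exp_kernel \<theta> s (\<phi> p) * h p \<partial>\<mu>)"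
  proof (rule integral_cong_AE)
    show "AE p in \<mu>. G p s - \<theta> * (\<integral>r. F r p \<partial>lborel) = exp_kernel \<theta> s (\<phi> p) * h p"
      using \<phi>
    proof eventually_elim
      case (elim p)
      then show ?case
        using \<open>0 < \<theta>\<close> by (auto simp: inner G_def exp_kernel_def field_simps)
    qed
  qed (use Gi int in measurable)
  finally show ?thesis by (simp add: G_def)
qed

section \<open>The filtered covariance as an integral against a planar measure\<close>

locale covariance_measure = finite_measure \<mu> for \<mu> :: "(real \<times> real) measure" +
  fixes \<theta> T :: real and R :: "real \<Rightarrow> real \<Rightarrow> real"
  assumes sets_eq [measurable_cong]: "sets \<mu> = sets (borel \<Otimes>\<^sub>M borel)"
    and \<theta>_pos: "0 < \<theta>" and T_nonneg: "0 \<le> T"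
    and support: "AE p in \<mu>. 0 \<le> fst p \<and> fst p \<le> T \<and> 0 \<le> snd p \<and> snd p \<le> T"
    and R_eq: "\<And>s t. 0 \<le> s \<Longrightarrow> s \<le> T \<Longrightarrow> 0 \<le> t \<Longrightarrow> t \<le> T \<Longrightarrow> R s t = measure \<mu> {p. fst p \<le> s \<and> snd p \<le> t}"
begin

definition cov :: "real \<Rightarrow> real \<Rightarrow> real" where
  "cov s t = (\<integral>p. exp_kernel \<theta> s (fst p) * exp_kernel \<theta> t (snd p) \<partial>\<mu>)"

text \<open>The filter acts first in the first argument, weighted by the indicator of the second
  coordinate, and then in the second argument, weighted by the kernel of the first; both weights lie
  between 0 and 1.\<close>

lemma exp_filter_R:
  assumes "0 \<le> s" "s \<le> T" "0 \<le> t" "t \<le> T"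
  shows "exp_filter \<theta> t (\<lambda>r. exp_filter \<theta> s (\<lambda>q. R q r)) = cov s t"
proof -
  have R_int: "R q r = (\<integral>p. (if fst p \<le> q then (if snd p \<le> r then 1 else 0) else 0) \<partial>\<mu>)"
    if "0 \<le> q" "q \<le> T" "0 \<le> r" "r \<le> T" for q r
  proof -
    have "(\<integral>p. (if fst p \<le> q then (if snd p \<le> r then 1 else 0) else 0) \<partial>\<mu>) = (\<integral>p. indicator {p. fst p \<le> q \<and> snd p \<le> r} p \<partial>\<mu>)"
      by (intro Bochner_Integration.integral_cong) (auto simp: indicator_def)
    also have "\<dots> = measure \<mu> {p. fst p \<le> q \<and> snd p \<le> r}"
      by (simp add: sets_eq_imp_space_eq[OF sets_eq] space_pair_measure)
    finally show ?thesis using R_eq that by simp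
  qed
  have ae: "AE p in \<mu>. 0 \<le> fst p" "AE p in \<mu>. 0 \<le> snd p"
    using support by auto
  have inner: "exp_filter \<theta> s (\<lambda>q. R q r) = (\<integral>p. (if snd p \<le> r then exp_kernel \<theta> s (fst p) else 0) \<partial>\<mu>)"
    if "0 \<le> r" "r \<le> T" for r
  proof -
    have "exp_filter \<theta> s (\<lambda>q. R q r) = exp_filter \<theta> s (\<lambda>q. (\<integral>p. (if fst p \<le> q then (if snd p \<le> r then 1 else 0) else 0) \<partial>\<mu>))"
      using assms that by (intro exp_filter_cong R_int) auto
    also have "\<dots> = (\<integral>p. exp_kernel \<theta> s (fst p) * (if snd p \<le> r then 1 else 0) \<partial>\<mu>)"
      using assms \<theta>_pos ae by (intro exp_filter_integral) (auto intro: finite_measure_axioms)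
    finally show ?thesis by (simp add: if_distrib[of "\<lambda>x. _ * x"] cong: if_cong)
  qed
  have "exp_filter \<theta> t (\<lambda>r. exp_filter \<theta> s (\<lambda>q. R q r))
      = exp_filter \<theta> t (\<lambda>r. \<integral>p. (if snd p \<le> r then exp_kernel \<theta> s (fst p) else 0) \<partial>\<mu>)"
    using assms by (intro exp_filter_cong inner) auto
  also have "\<dots> = (\<integral>p. exp_kernel \<theta> t (snd p) * exp_kernel \<theta> s (fst p) \<partial>\<mu>)"
    using assms \<theta>_pos ae exp_kernel_le_1
    by (intro exp_filter_integral) (auto intro: finite_measure_axioms)
  finally show ?thesis by (simp add: cov_def mult.commute)
qed

lemma integrable_kernels: "integrable \<mu> (\<lambda>p. exp_kernel \<theta> s (fst p) * exp_kernel \<theta> t (snd p))"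
  using exp_kernel_le_1[OF \<theta>_pos]
  by (intro integrable_const_bound[where B=1]) (auto simp: abs_mult intro!: mult_le_one)

lemma cov_nonneg: "0 \<le> cov s t"
  unfolding cov_def by (rule integral_nonneg_AE) simp

lemma cov_measurable [measurable (raw)]:
  assumes [measurable]: "f \<in> borel_measurable N" "g \<in> borel_measurable N"
  shows "(\<lambda>x. cov (f x) (g x)) \<in> borel_measurable N"
  unfolding cov_def by measurable

lemma ennreal_cov: "ennreal (cov s t) = (\<integral>\<^sup>+p. ennreal (exp_kernel \<theta> s (fst p)) * ennreal (exp_kernel \<theta> t (snd p)) \<partial>\<mu>)"
  unfolding cov_def
  by (subst nn_integral_eq_integral[symmetric, OF integrable_kernels]) (auto simp: ennreal_mult)

lemma exp_kernel_nn_integral_le: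
  assumes "0 \<le> u" "u \<le> T"
  shows "(\<integral>\<^sup>+t. ennreal (indicator {0..T} t * exp_kernel \<theta> t u) \<partial>lborel) \<le> ennreal (1 / \<theta>)"
proof -
  have "(\<integral>\<^sup>+t. ennreal (indicator {0..T} t * exp_kernel \<theta> t u) \<partial>lborel) = (\<integral>\<^sup>+t. ennreal (indicator {u..T} t * exp (- \<theta> * (t - u))) \<partial>lborel)"
    using assms by (intro nn_integral_cong) (auto simp: exp_kernel_def indicator_def)
  also have "\<dots> = ennreal ((1 - exp (- \<theta> * (T - u))) / \<theta>)"
    using assms \<theta>_pos exp_integral_left[of u T \<theta>]
    by (subst nn_integral_eq_integral) auto
  also have "\<dots> \<le> ennreal (1 / \<theta>)"
    using \<theta>_pos by (intro ennreal_leI divide_right_mono) auto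
  finally show ?thesis .
qed

text \<open>All terms are nonnegative, so the time integrals may be taken first. For a fixed point
  of the square they factor into two integrals of the exponential kernel, each at most
  \<open>1 / \<theta>\<close>.\<close>

lemma cov_double_integral:
  shows "integrable (lborel \<Otimes>\<^sub>M lborel) (\<lambda>(s, t). indicator {0..T} s * indicator {0..T} t * cov s t)"
    and "(\<integral>(s, t). indicator {0..T} s * indicator {0..T} t * cov s t \<partial>(lborel \<Otimes>\<^sub>M lborel)) \<le> measure \<mu> (space \<mu>) / \<theta>\<^sup>2"
proof -
  interpret P: pair_sigma_finite "lborel \<Otimes>\<^sub>M lborel :: (real \<times> real) measure" \<mu>
    by (intro pair_sigma_finite.intro sigma_finite_measure_axioms)
      (simp add: lborel_prod sigma_finite_lborel)
  define f :: "real \<Rightarrow> real \<Rightarrow> ennreal" where "f s u = ennreal (indicator {0..T} s * exp_kernel \<theta> s u)" for s u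
  have f_le: "(\<integral>\<^sup>+s. f s u \<partial>lborel) \<le> ennreal (1 / \<theta>)" if "0 \<le> u" "u \<le> T" for u
    unfolding f_def using exp_kernel_nn_integral_le that .
  have "(\<integral>\<^sup>+z. ennreal (case z of (s, t) \<Rightarrow> indicator {0..T} s * indicator {0..T} t * cov s t) \<partial>(lborel \<Otimes>\<^sub>M lborel))
      = (\<integral>\<^sup>+z. (\<integral>\<^sup>+p. f (fst z) (fst p) * f (snd z) (snd p) \<partial>\<mu>) \<partial>(lborel \<Otimes>\<^sub>M lborel))"
  proof (intro nn_integral_cong)
    fix z :: "real \<times> real"
    show "ennreal (case z of (s, t) \<Rightarrow> indicator {0..T} s * indicator {0..T} t * cov s t) = (\<integral>\<^sup>+p. f (fst z) (fst p) * f (snd z) (snd p) \<partial>\<mu>)"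
      using ennreal_cov[of "fst z" "snd z"]
      by (cases z) (auto simp: f_def indicator_def)
  qed
  also have "\<dots> = (\<integral>\<^sup>+p. (\<integral>\<^sup>+z. f (fst z) (fst p) * f (snd z) (snd p) \<partial>(lborel \<Otimes>\<^sub>M lborel)) \<partial>\<mu>)"
    by (rule P.Fubini'[symmetric]) (simp add: f_def)
  also have "\<dots> \<le> (\<integral>\<^sup>+p. ennreal (1 / \<theta>\<^sup>2) \<partial>\<mu>)"
  proof (rule nn_integral_mono_AE)
    show "AE p in \<mu>. (\<integral>\<^sup>+z. f (fst z) (fst p) * f (snd z) (snd p) \<partial>(lborel \<Otimes>\<^sub>M lborel)) \<le> ennreal (1 / \<theta>\<^sup>2)"
      using support
    proof eventually_elim
      case (elim p)
      have "(\<integral>\<^sup>+z. f (fst z) (fst p) * f (snd z) (snd p) \<partial>(lborel \<Otimes>\<^sub>M lborel))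
          = (\<integral>\<^sup>+s. (\<integral>\<^sup>+t. f s (fst p) * f t (snd p) \<partial>lborel) \<partial>lborel)"
        by (subst lborel.nn_integral_fst[symmetric]) (auto simp: f_def)
      also have "\<dots> = (\<integral>\<^sup>+s. f s (fst p) \<partial>lborel) * (\<integral>\<^sup>+t. f t (snd p) \<partial>lborel)"
        by (subst nn_integral_cmult) (auto simp: f_def intro!: nn_integral_multc)
      also have "\<dots> \<le> ennreal (1 / \<theta>) * ennreal (1 / \<theta>)"
        using elim by (intro mult_mono f_le) auto
      also have "\<dots> = ennreal (1 / \<theta>\<^sup>2)"
        using \<theta>_pos by (simp add: power2_eq_square flip: ennreal_mult)
      finally show ?case .
    qed
  qed
  also have "\<dots> = ennreal (measure \<mu> (space \<mu>) / \<theta>\<^sup>2)"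
    by (simp add: emeasure_eq_measure flip: ennreal_mult)
  finally have le: "(\<integral>\<^sup>+z. ennreal (case z of (s, t) \<Rightarrow> indicator {0..T} s * indicator {0..T} t * cov s t) \<partial>(lborel \<Otimes>\<^sub>M lborel))
     \<le> ennreal (measure \<mu> (space \<mu>) / \<theta>\<^sup>2)" .
  have [measurable]: "(\<lambda>(s, t). indicator {0..T} s * indicator {0..T} t * cov s t) \<in> borel_measurable (lborel \<Otimes>\<^sub>M lborel)"
    by measurable
  show "integrable (lborel \<Otimes>\<^sub>M lborel) (\<lambda>(s, t). indicator {0..T} s * indicator {0..T} t * cov s t)"
  proof (rule integrableI_nonneg)
    show "AE z in lborel \<Otimes>\<^sub>M lborel. 0 \<le> (case z of (s, t) \<Rightarrow> indicator {0..T} s * indicator {0..T} t * cov s t)"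
      by (intro AE_I2) (auto simp: cov_nonneg)
    show "(\<integral>\<^sup>+z. ennreal (case z of (s, t) \<Rightarrow> indicator {0..T} s * indicator {0..T} t * cov s t) \<partial>(lborel \<Otimes>\<^sub>M lborel)) < \<infinity>"
      using le by (rule le_less_trans) simp
  qed simp
  have "(\<integral>(s, t). indicator {0..T} s * indicator {0..T} t * cov s t \<partial>(lborel \<Otimes>\<^sub>M lborel))
    = enn2real (\<integral>\<^sup>+z. ennreal (case z of (s, t) \<Rightarrow> indicator {0..T} s * indicator {0..T} t * cov s t) \<partial>(lborel \<Otimes>\<^sub>M lborel))"
    by (intro integral_eq_nn_integral) (auto intro!: AE_I2 simp: cov_nonneg)
  also have "\<dots> \<le> measure \<mu> (space \<mu>) / \<theta>\<^sup>2"
    by (intro enn2real_leI le) auto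
  finally show "(\<integral>(s, t). indicator {0..T} s * indicator {0..T} t * cov s t \<partial>(lborel \<Otimes>\<^sub>M lborel)) \<le> measure \<mu> (space \<mu>) / \<theta>\<^sup>2" .
qed

text \<open>The energy identity: with \<open>m = max u v\<close> the product of the kernels at \<open>(u, v)\<close> is
  \<open>exp (- \<theta> * \<bar>u - v\<bar>)\<close> times a solution of \<open>y' = - 2 * \<theta> * y\<close> started at time \<open>m\<close> from \<open>1\<close>.\<close>

lemma cov_energy:
  shows "integrable lborel (\<lambda>t. indicator {0..T} t * cov t t)"
    and "cov T T + 2 * \<theta> * (\<integral>t. indicator {0..T} t * cov t t \<partial>lborel) = (\<integral>p. exp (- \<theta> * \<bar>fst p - snd p\<bar>) \<partial>\<mu>)"
proof -
  note sigma_finite_\<mu> = sigma_finite_measure_axioms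
  interpret pair_sigma_finite lborel \<mu> ..
  define F where "F t p = indicator {0..T} t * (exp_kernel \<theta> t (fst p) * exp_kernel \<theta> t (snd p))" for t p
  have [measurable]: "(\<lambda>(t, p). F t p) \<in> borel_measurable (lborel \<Otimes>\<^sub>M \<mu>)"
    unfolding F_def by measurable
  have F: "integrable (lborel \<Otimes>\<^sub>M \<mu>) (\<lambda>(t, p). F t p)"
  proof (rule integrable_pair_bound[where b="\<lambda>t. indicator {0..T} t * measure \<mu> (space \<mu>)"])
    fix t :: real
    show *: "integrable \<mu> (\<lambda>p. case (t, p) of (t, p) \<Rightarrow> F t p)"
      using integrable_kernels[of t t] by (simp add: F_def)
    have "(\<integral>p. \<bar>F t p\<bar> \<partial>\<mu>) \<le> (\<integral>p. indicator {0..T} t \<partial>\<mu>)"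
      using * exp_kernel_le_1[OF \<theta>_pos]
      by (intro integral_mono) (auto simp: F_def indicator_def abs_mult intro!: mult_le_one)
    then show "(\<integral>p. \<bar>case (t, p) of (t, p) \<Rightarrow> F t p\<bar> \<partial>\<mu>) \<le> indicator {0..T} t * measure \<mu> (space \<mu>)"
      by (simp add: mult.commute)
  qed (auto simp: emeasure_lborel_Icc_eq intro: sigma_finite_lborel sigma_finite_\<mu>)
  have cov_F: "indicator {0..T} t * cov t t = (\<integral>p. F t p \<partial>\<mu>)" for t
    by (simp add: F_def cov_def)
  show "integrable lborel (\<lambda>t. indicator {0..T} t * cov t t)"
    unfolding cov_F using integrable_fst[OF F] .
  have inner: "(\<integral>t. F t p \<partial>lborel) = exp (- \<theta> * \<bar>fst p - snd p\<bar>) * ((1 - exp (- (2 * \<theta>) * (T - max (fst p) (snd p)))) / (2 * \<theta>))"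
    if "0 \<le> fst p" "fst p \<le> T" "0 \<le> snd p" "snd p \<le> T" for p
  proof -
    have "(\<integral>t. F t p \<partial>lborel) = (\<integral>t. exp (- \<theta> * \<bar>fst p - snd p\<bar>) * (indicator {max (fst p) (snd p)..T} t * exp (- (2 * \<theta>) * (t - max (fst p) (snd p)))) \<partial>lborel)"
      using that by (intro Bochner_Integration.integral_cong)
        (auto simp: F_def exp_kernel_def indicator_def max_def abs_if algebra_simps simp flip: exp_add)
    also have "\<dots> = exp (- \<theta> * \<bar>fst p - snd p\<bar>) * ((1 - exp (- (2 * \<theta>) * (T - max (fst p) (snd p)))) / (2 * \<theta>))"
      using exp_integral_left(2)[of "max (fst p) (snd p)" T "2 * \<theta>"] that \<theta>_pos
      by (subst integral_mult_right_zero) simp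
    finally show ?thesis .
  qed
  have int: "integrable \<mu> (\<lambda>p. \<integral>t. F t p \<partial>lborel)"
    using integrable_snd[OF F] .
  have "cov T T + 2 * \<theta> * (\<integral>t. indicator {0..T} t * cov t t \<partial>lborel)
     = cov T T + 2 * \<theta> * (\<integral>p. (\<integral>t. F t p \<partial>lborel) \<partial>\<mu>)"
    unfolding cov_F using Fubini_integral[OF F] by simp
  also have "\<dots> = (\<integral>p. exp_kernel \<theta> T (fst p) * exp_kernel \<theta> T (snd p) + 2 * \<theta> * (\<integral>t. F t p \<partial>lborel) \<partial>\<mu>)"
    unfolding cov_def using int integrable_kernels[of T T] by simp
  also have "\<dots> = (\<integral>p. exp (- \<theta> * \<bar>fst p - snd p\<bar>) \<partial>\<mu>)"
  proof (rule integral_cong_AE)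
    show "AE p in \<mu>. exp_kernel \<theta> T (fst p) * exp_kernel \<theta> T (snd p) + 2 * \<theta> * (\<integral>t. F t p \<partial>lborel) = exp (- \<theta> * \<bar>fst p - snd p\<bar>)"
      using support
    proof eventually_elim
      case (elim p)
      define E where "E = exp (- \<theta> * \<bar>fst p - snd p\<bar>)"
      define D where "D = exp (- (2 * \<theta>) * (T - max (fst p) (snd p)))"
      have "exp_kernel \<theta> T (fst p) * exp_kernel \<theta> T (snd p) = E * D"
        using elim by (auto simp: E_def D_def exp_kernel_def max_def abs_if algebra_simps simp flip: exp_add)
      moreover have "2 * \<theta> * (\<integral>t. F t p \<partial>lborel) = E * (1 - D)"
        using elim \<theta>_pos by (subst inner) (auto simp: E_def D_def)
      ultimately show ?case unfolding E_def[symmetric] by (simp add: algebra_simps)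
    qed
  qed (use int in measurable)
  finally show "cov T T + 2 * \<theta> * (\<integral>t. indicator {0..T} t * cov t t \<partial>lborel) = (\<integral>p. exp (- \<theta> * \<bar>fst p - snd p\<bar>) \<partial>\<mu>)" .
qed

end

section \<open>The covariance measure of the mixed process\<close>

text \<open>The signed power \<open>sgn x * \<bar>x\<bar> powr p\<close>: the antiderivative of
  \<open>p * \<bar>x\<bar> powr (p - 1)\<close> that stays continuous across 0 when
  \<open>0 < p\<close>.\<close>

definition sgn_powr :: "real \<Rightarrow> real \<Rightarrow> real" where
  "sgn_powr p x = max 0 x powr p - max 0 (- x) powr p"

lemma continuous_on_sgn_powr [continuous_intros]:
  assumes "continuous_on A f" "0 < p"
  shows "continuous_on A (\<lambda>x. sgn_powr p (f x))"
  unfolding sgn_powr_def using assms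
  by (intro continuous_on_diff continuous_on_powr' continuous_on_max continuous_on_minus continuous_on_const) auto

lemma DERIV_sgn_powr:
  assumes "x \<noteq> 0"
  shows "(sgn_powr p has_real_derivative p * \<bar>x\<bar> powr (p - 1)) (at x)"
proof (cases "0 < x")
  case True
  have "((\<lambda>x. x powr p) has_real_derivative p * \<bar>x\<bar> powr (p - 1)) (at x)"
    using True by (auto intro!: derivative_eq_intros)
  then show ?thesis
    by (rule has_field_derivative_transform_within_open[of _ _ _ "{0<..}"])
      (use True in \<open>auto simp: sgn_powr_def\<close>)
next
  case False
  with assms have x: "x < 0" by simp
  have "((\<lambda>x. - ((- x) powr p)) has_real_derivative p * \<bar>x\<bar> powr (p - 1)) (at x)"
    using x by (auto intro!: derivative_eq_intros)
  then show ?thesis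
    by (rule has_field_derivative_transform_within_open[of _ _ _ "{..<0}"])
      (use x in \<open>auto simp: sgn_powr_def\<close>)
qed

lemma DERIV_abs_powr:
  assumes "x \<noteq> (0::real)"
  shows "((\<lambda>x. \<bar>x\<bar> powr q) has_real_derivative q * sgn_powr (q - 1) x) (at x)"
proof (cases "0 < x")
  case True
  have "((\<lambda>x. x powr q) has_real_derivative q * sgn_powr (q - 1) x) (at x)"
    using True by (auto intro!: derivative_eq_intros simp: sgn_powr_def)
  then show ?thesis
    by (rule has_field_derivative_transform_within_open[of _ _ _ "{0<..}"])
      (use True in auto)
next
  case False
  with assms have x: "x < 0" by simp
  have "((\<lambda>x. (- x) powr q) has_real_derivative q * sgn_powr (q - 1) x) (at x)"
    using x by (auto intro!: derivative_eq_intros simp: sgn_powr_def)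
  then show ?thesis
    by (rule has_field_derivative_transform_within_open[of _ _ _ "{..<0}"])
      (use x in auto)
qed

section \<open>The density of the sub-fractional covariance\<close>

locale hurst =
  fixes H :: real
  assumes H_gt: "1/2 < H" and H_lt: "H < 1"
begin

text \<open>Off the diagonal, \<open>alpha_H H\<close> times this is the mixed second derivative of
  \<open>subfBm_cov H\<close>. On the diagonal \<open>0 powr (2*H - 2)\<close> is 0, so the formula
  would turn negative there; the value 0 keeps the kernel nonnegative.\<close>

definition sfbm_kernel :: "real \<Rightarrow> real \<Rightarrow> real" where
  "sfbm_kernel u v = (if u = v then 0 else \<bar>u - v\<bar> powr (2*H - 2) - (u + v) powr (2*H - 2))"

lemma alpha_pos: "0 < alpha_H H"
  using H_gt by (simp add: alpha_H_def)

lemma sfbm_kernel_commute: "sfbm_kernel u v = sfbm_kernel v u"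
  by (simp add: sfbm_kernel_def add.commute abs_minus_commute)

text \<open>A power with negative exponent is decreasing, and
  \<open>\<bar>u - v\<bar> \<le> u + v\<close>.\<close>

lemma sfbm_kernel_nonneg: "0 \<le> u \<Longrightarrow> 0 \<le> v \<Longrightarrow> 0 \<le> sfbm_kernel u v"
  using H_lt by (auto simp: sfbm_kernel_def intro!: powr_mono2')

lemma sfbm_kernel_le: "sfbm_kernel u v \<le> \<bar>u - v\<bar> powr (2*H - 2)"
  by (simp add: sfbm_kernel_def)

lemma sfbm_kernel_measurable [measurable (raw)]:
  assumes [measurable]: "f \<in> borel_measurable N" "g \<in> borel_measurable N"
  shows "(\<lambda>x. sfbm_kernel (f x) (g x)) \<in> borel_measurable N"
  unfolding sfbm_kernel_def by measurable

text \<open>The partial derivative of \<open>subfBm_cov H s t\<close> with respect to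
  \<open>s\<close>, taken at \<open>s = u\<close>.\<close>

definition sfbm_kernel_int :: "real \<Rightarrow> real \<Rightarrow> real" where
  "sfbm_kernel_int u t = H * (sgn_powr (2*H - 1) (t - u) + 2 * u powr (2*H - 1) - (u + t) powr (2*H - 1))"

text \<open>The antiderivative in \<open>v\<close> is continuous but not differentiable at
  \<open>v = u\<close>, because \<open>2*H - 1\<close> lies between 0 and 1. A fundamental theorem
  with one exceptional point absorbs the singularity of the kernel.\<close>

lemma has_integral_sfbm_kernel:
  assumes "0 \<le> u" "0 \<le> t"
  shows "((\<lambda>v. alpha_H H * sfbm_kernel u v) has_integral sfbm_kernel_int u t) {0..t}"
proof -
  define F where "F v = H * (sgn_powr (2*H - 1) (v - u) - (u + v) powr (2*H - 1))" for v
  have "((\<lambda>v. alpha_H H * sfbm_kernel u v) has_integral (F t - F 0)) {0..t}"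
  proof (rule fundamental_theorem_of_calculus_interior_strong[of "{u}"])
    fix v assume v: "v \<in> {0<..<t} - {u}"
    have "((\<lambda>v. sgn_powr (2*H - 1) (v - u)) has_real_derivative (2*H - 1) * \<bar>v - u\<bar> powr (2*H - 1 - 1) * 1) (at v)"
      by (rule DERIV_chain2[where f="sgn_powr (2*H - 1)" and g="\<lambda>v. v - u"], rule DERIV_sgn_powr)
        (use v in \<open>auto intro!: derivative_eq_intros\<close>)
    then have "(F has_real_derivative H * ((2*H - 1) * \<bar>v - u\<bar> powr (2*H - 2) - (2*H - 1) * (u + v) powr (2*H - 2))) (at v)"
      unfolding F_def using v assms
      by (auto intro!: derivative_eq_intros)
    then show "(F has_vector_derivative alpha_H H * sfbm_kernel u v) (at v)"
      using v by (auto simp: has_real_derivative_iff_has_vector_derivative alpha_H_def sfbm_kernel_def algebra_simps abs_minus_commute)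
  next
    show "continuous_on {0..t} F"
      unfolding F_def using assms H_gt by (intro continuous_on_diff continuous_on_mult continuous_on_divide continuous_on_powr' continuous_on_add
          continuous_on_rabs continuous_on_sgn_powr continuous_on_id continuous_on_const) auto
  qed (use assms in auto)
  moreover have "F t - F 0 = sfbm_kernel_int u t"
    using assms by (simp add: F_def sfbm_kernel_int_def sgn_powr_def algebra_simps)
  ultimately show ?thesis by simp
qed

lemma has_integral_sfbm_kernel_int:
  assumes "0 \<le> s" "0 \<le> t"
  shows "((\<lambda>u. sfbm_kernel_int u t) has_integral subfBm_cov H s t) {0..s}"
proof -
  define F where "F u = u powr (2*H) - \<bar>t - u\<bar> powr (2*H) / 2 - (u + t) powr (2*H) / 2" for u
  have "((\<lambda>u. sfbm_kernel_int u t) has_integral (F s - F 0)) {0..s}"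
  proof (rule fundamental_theorem_of_calculus_interior_strong[of "{t}"])
    fix u assume u: "u \<in> {0<..<s} - {t}"
    have d: "((\<lambda>u. \<bar>t - u\<bar> powr (2*H)) has_real_derivative 2*H * sgn_powr (2*H - 1) (t - u) * (-1)) (at u)"
      by (rule DERIV_chain2[where f="\<lambda>x. \<bar>x\<bar> powr (2*H)" and g="\<lambda>u. t - u"], rule DERIV_abs_powr)
        (use u in \<open>auto intro!: derivative_eq_intros\<close>)
    have d1: "((\<lambda>u. u powr (2*H)) has_real_derivative 2*H * u powr (2*H - 1)) (at u)"
      using u by (auto intro!: derivative_eq_intros)
    have d2: "((\<lambda>u. (u + t) powr (2*H)) has_real_derivative 2*H * (u + t) powr (2*H - 1)) (at u)"
      using u assms by (auto intro!: derivative_eq_intros)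
    have "(F has_real_derivative 2*H * u powr (2*H - 1) - 2*H * sgn_powr (2*H - 1) (t - u) * (-1) / 2 - 2*H * (u + t) powr (2*H - 1) / 2) (at u)"
      unfolding F_def by (intro DERIV_diff DERIV_cdivide d d1 d2)
    then show "(F has_vector_derivative sfbm_kernel_int u t) (at u)"
      by (simp add: has_real_derivative_iff_has_vector_derivative sfbm_kernel_int_def algebra_simps)
  next
    show "continuous_on {0..s} F"
      unfolding F_def using assms H_gt by (intro continuous_on_diff continuous_on_mult continuous_on_divide continuous_on_powr' continuous_on_add
          continuous_on_rabs continuous_on_sgn_powr continuous_on_id continuous_on_const) auto
  qed (use assms in auto)
  moreover have "F s - F 0 = subfBm_cov H s t"
    using assms by (simp add: F_def subfBm_cov_def abs_minus_commute field_simps)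
  ultimately show ?thesis by simp
qed

text \<open>Both iterated integrals are evaluated by antiderivatives; thus
  \<open>alpha_H H * sfbm_kernel\<close> is a density on the quadrant whose distribution function is
  the sub-fractional covariance.\<close>

lemma nn_integral_sfbm_kernel:
  assumes "0 \<le> s" "0 \<le> t"
  shows "(\<integral>\<^sup>+u. (\<integral>\<^sup>+v. ennreal (alpha_H H * sfbm_kernel u v) * indicator {0..t} v \<partial>lborel) * indicator {0..s} u \<partial>lborel) = ennreal (subfBm_cov H s t)"
proof -
  have inner: "(\<integral>\<^sup>+v. ennreal (alpha_H H * sfbm_kernel u v) * indicator {0..t} v \<partial>lborel) = ennreal (sfbm_kernel_int u t)" if "0 \<le> u" for u
    using that assms alpha_pos by (intro nn_integral_has_integral_lebesgue' has_integral_sfbm_kernel)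
      (auto intro!: mult_nonneg_nonneg sfbm_kernel_nonneg)
  have nn: "0 \<le> sfbm_kernel_int u t" if "0 \<le> u" for u
    by (rule has_integral_nonneg[OF has_integral_sfbm_kernel])
      (use that assms alpha_pos in \<open>auto intro!: mult_nonneg_nonneg sfbm_kernel_nonneg\<close>)
  have "(\<integral>\<^sup>+u. (\<integral>\<^sup>+v. ennreal (alpha_H H * sfbm_kernel u v) * indicator {0..t} v \<partial>lborel) * indicator {0..s} u \<partial>lborel)
     = (\<integral>\<^sup>+u. ennreal (sfbm_kernel_int u t) * indicator {0..s} u \<partial>lborel)"
    proof (rule nn_integral_cong)
    fix u :: real
    show "(\<integral>\<^sup>+v. ennreal (alpha_H H * sfbm_kernel u v) * indicator {0..t} v \<partial>lborel) * indicator {0..s} u = ennreal (sfbm_kernel_int u t) * indicator {0..s} u"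
      by (cases "0 \<le> u") (simp_all add: inner)
  qed
  also have "\<dots> = ennreal (subfBm_cov H s t)"
    using assms nn by (intro nn_integral_has_integral_lebesgue' has_integral_sfbm_kernel_int) auto
  finally show ?thesis .
qed

lemma subfBm_cov_nonneg:
  assumes "0 \<le> s" "0 \<le> t"
  shows "0 \<le> subfBm_cov H s t"
proof (rule has_integral_nonneg[OF has_integral_sfbm_kernel_int])
  fix u assume "u \<in> {0..s}"
  then show "0 \<le> sfbm_kernel_int u t"
    by (intro has_integral_nonneg[OF has_integral_sfbm_kernel])
      (use assms alpha_pos in \<open>auto intro!: mult_nonneg_nonneg sfbm_kernel_nonneg\<close>)
qed (use assms in auto)

text \<open>The covariance measure of the mixed process on \<open>[0, T]\<^sup>2\<close>: Lebesgue measure on the diagonal, for the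
  Brownian part, plus the density \<^const>\<open>sfbm_kernel\<close>. Both are obtained from one planar density by
  folding the strip \<open>[0, T] \<times> [-1, 0)\<close> onto the diagonal.\<close>

definition mixed_density :: "real \<Rightarrow> real \<times> real \<Rightarrow> ennreal" where
  "mixed_density T = (\<lambda>(u, w). indicator {0..T} u *
     (if w < 0 then indicator {-1..<0} w else ennreal (alpha_H H * sfbm_kernel u w) * indicator {0..T} w))"

definition mixed_measure :: "real \<Rightarrow> (real \<times> real) measure" where
  "mixed_measure T = distr (density (lborel \<Otimes>\<^sub>M lborel) (mixed_density T)) (borel \<Otimes>\<^sub>M borel)
     (\<lambda>(u, w). if w < 0 then (u, u) else (u, w))"

lemma sets_mixed_measure [measurable_cong, simp]: "sets (mixed_measure T) = sets (borel \<Otimes>\<^sub>M borel)"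
  by (simp add: mixed_measure_def)

text \<open>The folded strip has height 1, so the diagonal receives Lebesgue measure with weight
  exactly 1. Later integrals against the measure are computed from this formula.\<close>

lemma nn_integral_mixed_measure:
  assumes [measurable]: "F \<in> borel_measurable (borel \<Otimes>\<^sub>M borel)"
  shows "(\<integral>\<^sup>+p. F p \<partial>mixed_measure T) = (\<integral>\<^sup>+u. F (u, u) * indicator {0..T} u \<partial>lborel)
     + (\<integral>\<^sup>+u. (\<integral>\<^sup>+v. ennreal (alpha_H H * sfbm_kernel u v) * indicator {0..T} v * F (u, v) \<partial>lborel) * indicator {0..T} u \<partial>lborel)"
proof -
  define h where "h = (\<lambda>(u::real, w::real). if w < 0 then (u, u) else (u, w))"
  have [measurable]: "h \<in> borel \<Otimes>\<^sub>M borel \<rightarrow>\<^sub>M borel \<Otimes>\<^sub>M borel"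
    unfolding h_def by measurable
  have [measurable]: "mixed_density T \<in> borel_measurable (borel \<Otimes>\<^sub>M borel)"
    unfolding mixed_density_def by measurable
  define K where "K u v = ennreal (alpha_H H * sfbm_kernel u v) * indicator {0..T} v * F (u, v)" for u v
  have [measurable]: "case_prod K \<in> borel_measurable (borel \<Otimes>\<^sub>M borel)"
    unfolding K_def by measurable
  have "(\<integral>\<^sup>+p. F p \<partial>mixed_measure T) = (\<integral>\<^sup>+z. mixed_density T z * F (h z) \<partial>(lborel \<Otimes>\<^sub>M lborel))"
    unfolding mixed_measure_def h_def[symmetric]
    by (subst nn_integral_distr, simp, simp, subst nn_integral_density) auto
  also have "\<dots> = (\<integral>\<^sup>+u. (\<integral>\<^sup>+w. mixed_density T (u, w) * F (h (u, w)) \<partial>lborel) \<partial>lborel)"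
    by (subst lborel.nn_integral_fst[symmetric]) auto
  also have "\<dots> = (\<integral>\<^sup>+u. F (u, u) * indicator {0..T} u + (\<integral>\<^sup>+v. K u v \<partial>lborel) * indicator {0..T} u \<partial>lborel)"
  proof (rule nn_integral_cong)
    fix u :: real
    have [measurable]: "K u \<in> borel_measurable borel"
      unfolding K_def by measurable
    have "(\<integral>\<^sup>+w. mixed_density T (u, w) * F (h (u, w)) \<partial>lborel)
        = (\<integral>\<^sup>+w. indicator {0..T} u * F (u, u) * indicator {-1..<0} w + indicator {0..T} u * K u w \<partial>lborel)"
      by (intro nn_integral_cong) (auto simp: mixed_density_def h_def K_def indicator_def)
    also have "\<dots> = indicator {0..T} u * F (u, u) + indicator {0..T} u * (\<integral>\<^sup>+v. K u v \<partial>lborel)"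
      by (subst nn_integral_add) (auto simp: nn_integral_cmult nn_integral_cmult_indicator)
    finally show "(\<integral>\<^sup>+w. mixed_density T (u, w) * F (h (u, w)) \<partial>lborel) = F (u, u) * indicator {0..T} u + (\<integral>\<^sup>+v. K u v \<partial>lborel) * indicator {0..T} u"
      by (simp add: mult.commute)
  qed
  also have "\<dots> = (\<integral>\<^sup>+u. F (u, u) * indicator {0..T} u \<partial>lborel) + (\<integral>\<^sup>+u. (\<integral>\<^sup>+v. K u v \<partial>lborel) * indicator {0..T} u \<partial>lborel)"
    by (rule nn_integral_add) auto
  finally show ?thesis unfolding K_def .
qed

section \<open>Rectangles, support and total mass of the mixed measure\<close>

definition mixed_cov :: "real \<Rightarrow> real \<Rightarrow> real" where
  "mixed_cov s t = min s t + subfBm_cov H s t"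

lemma emeasure_mixed_measure:
  assumes "0 \<le> s" "s \<le> T" "0 \<le> t" "t \<le> T"
  shows "emeasure (mixed_measure T) {p. fst p \<le> s \<and> snd p \<le> t} = ennreal (mixed_cov s t)"
proof -
  define A where "A = {p::real \<times> real. fst p \<le> s \<and> snd p \<le> t}"
  have A[measurable]: "A \<in> sets (borel \<Otimes>\<^sub>M borel)"
    unfolding A_def borel_prod by (simp add: borel_closed closed_Collect_conj closed_Collect_le continuous_on_fst continuous_on_snd)
  have "emeasure (mixed_measure T) A = (\<integral>\<^sup>+p. indicator A p \<partial>mixed_measure T)"
    by simp
  also have "\<dots> = (\<integral>\<^sup>+u. indicator A (u, u) * indicator {0..T} u \<partial>lborel)
     + (\<integral>\<^sup>+u. (\<integral>\<^sup>+v. ennreal (alpha_H H * sfbm_kernel u v) * indicator {0..T} v * indicator A (u, v) \<partial>lborel) * indicator {0..T} u \<partial>lborel)"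
    by (rule nn_integral_mixed_measure) simp
  also have "(\<integral>\<^sup>+u. indicator A (u, u) * indicator {0..T} u \<partial>lborel) = (\<integral>\<^sup>+u. indicator {0..min s t} u \<partial>lborel)"
    using assms by (intro nn_integral_cong) (auto simp: A_def indicator_def)
  also have "\<dots> = ennreal (min s t)"
    using assms by simp
  also have "(\<integral>\<^sup>+u. (\<integral>\<^sup>+v. ennreal (alpha_H H * sfbm_kernel u v) * indicator {0..T} v * indicator A (u, v) \<partial>lborel) * indicator {0..T} u \<partial>lborel)
     = (\<integral>\<^sup>+u. (\<integral>\<^sup>+v. ennreal (alpha_H H * sfbm_kernel u v) * indicator {0..t} v \<partial>lborel) * indicator {0..s} u \<partial>lborel)"
  proof (rule nn_integral_cong)
    fix u :: real
    have "(\<integral>\<^sup>+v. ennreal (alpha_H H * sfbm_kernel u v) * indicator {0..T} v * indicator A (u, v) \<partial>lborel)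
      = (\<integral>\<^sup>+v. ennreal (alpha_H H * sfbm_kernel u v) * indicator {0..t} v * indicator {..s} u \<partial>lborel)"
      using assms by (intro nn_integral_cong) (auto simp: A_def indicator_def)
    also have "\<dots> = (\<integral>\<^sup>+v. ennreal (alpha_H H * sfbm_kernel u v) * indicator {0..t} v \<partial>lborel) * indicator {..s} u"
      by (rule nn_integral_multc) simp
    finally show "(\<integral>\<^sup>+v. ennreal (alpha_H H * sfbm_kernel u v) * indicator {0..T} v * indicator A (u, v) \<partial>lborel) * indicator {0..T} u
       = (\<integral>\<^sup>+v. ennreal (alpha_H H * sfbm_kernel u v) * indicator {0..t} v \<partial>lborel) * indicator {0..s} u"
      using assms by (auto simp: indicator_def)
  qed
  also have "\<dots> = ennreal (subfBm_cov H s t)"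
    using assms by (intro nn_integral_sfbm_kernel) auto
  also have "ennreal (min s t) + \<dots> = ennreal (mixed_cov s t)"
    using assms subfBm_cov_nonneg by (simp add: mixed_cov_def ennreal_plus)
  finally show ?thesis unfolding A_def .
qed

lemma AE_mixed_measure:
  "AE p in mixed_measure T. 0 \<le> fst p \<and> fst p \<le> T \<and> 0 \<le> snd p \<and> snd p \<le> T"
proof -
  define N where "N = {p::real \<times> real. \<not> (0 \<le> fst p \<and> fst p \<le> T \<and> 0 \<le> snd p \<and> snd p \<le> T)}"
  have "Measurable.pred (borel \<Otimes>\<^sub>M borel) (\<lambda>p::real \<times> real. \<not> (0 \<le> fst p \<and> fst p \<le> T \<and> 0 \<le> snd p \<and> snd p \<le> T))"
    by measurable
  then have N[measurable]: "N \<in> sets (borel \<Otimes>\<^sub>M borel)"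
    by (simp add: N_def pred_def space_pair_measure)
  have "emeasure (mixed_measure T) N = (\<integral>\<^sup>+p. indicator N p \<partial>mixed_measure T)"
    by simp
  also have "\<dots> = (\<integral>\<^sup>+u. indicator N (u, u) * indicator {0..T} u \<partial>lborel)
     + (\<integral>\<^sup>+u. (\<integral>\<^sup>+v. ennreal (alpha_H H * sfbm_kernel u v) * indicator {0..T} v * indicator N (u, v) \<partial>lborel) * indicator {0..T} u \<partial>lborel)"
    by (rule nn_integral_mixed_measure) simp
  also have "(\<integral>\<^sup>+u. indicator N (u, u) * indicator {0..T} u \<partial>lborel) = (\<integral>\<^sup>+u. 0 \<partial>(lborel :: real measure))"
    by (intro nn_integral_cong) (auto simp: N_def indicator_def)
  also have "(\<integral>\<^sup>+u. (\<integral>\<^sup>+v. ennreal (alpha_H H * sfbm_kernel u v) * indicator {0..T} v * indicator N (u, v) \<partial>lborel) * indicator {0..T} u \<partial>lborel)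
    = (\<integral>\<^sup>+u. 0 \<partial>(lborel :: real measure))"
  proof (rule nn_integral_cong)
    fix u :: real
    have "(\<integral>\<^sup>+v. ennreal (alpha_H H * sfbm_kernel u v) * indicator {0..T} v * indicator N (u, v) \<partial>lborel) = (\<integral>\<^sup>+v. 0 \<partial>(lborel :: real measure))"
      if "u \<in> {0..T}" using that by (intro nn_integral_cong) (auto simp: N_def indicator_def)
    then show "(\<integral>\<^sup>+v. ennreal (alpha_H H * sfbm_kernel u v) * indicator {0..T} v * indicator N (u, v) \<partial>lborel) * indicator {0..T} u = 0"
      by (cases "u \<in> {0..T}") auto
  qed
  finally have "N \<in> null_sets (mixed_measure T)" by (simp add: null_sets_def)
  then show ?thesis
    by (rule AE_I') (auto simp: N_def)
qed

lemma mixed_covariance_measure: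
  assumes "0 < \<theta>" "0 \<le> T"
  shows "covariance_measure (mixed_measure T) \<theta> T mixed_cov"
    and "measure (mixed_measure T) (space (mixed_measure T)) = mixed_cov T T"
proof -
  have nn: "0 \<le> mixed_cov s t" if "0 \<le> s" "0 \<le> t" for s t
    using that subfBm_cov_nonneg by (simp add: mixed_cov_def)
  have sp: "space (mixed_measure T) = UNIV"
    by (simp add: mixed_measure_def space_pair_measure)
  have "emeasure (mixed_measure T) (space (mixed_measure T)) = emeasure (mixed_measure T) {p. fst p \<le> T \<and> snd p \<le> T}"
  proof (rule emeasure_eq_AE)
    show "AE p in mixed_measure T. p \<in> space (mixed_measure T) \<longleftrightarrow> p \<in> {p. fst p \<le> T \<and> snd p \<le> T}"
      using AE_mixed_measure by eventually_elim (auto simp: sp)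
    have "Measurable.pred (borel \<Otimes>\<^sub>M borel) (\<lambda>p::real \<times> real. fst p \<le> T \<and> snd p \<le> T)"
      by measurable
    then show "{p. fst p \<le> T \<and> snd p \<le> T} \<in> sets (mixed_measure T)"
      by (simp add: pred_def space_pair_measure)
  qed (rule sets.top)
  also have "\<dots> = ennreal (mixed_cov T T)"
    using assms by (intro emeasure_mixed_measure) auto
  finally have tot: "emeasure (mixed_measure T) (space (mixed_measure T)) = ennreal (mixed_cov T T)" .
  then show "measure (mixed_measure T) (space (mixed_measure T)) = mixed_cov T T"
    using nn assms by (simp add: measure_def)
  interpret finite_measure "mixed_measure T"
    using tot by (intro finite_measureI) simp
  show "covariance_measure (mixed_measure T) \<theta> T mixed_cov"
  proof unfold_locales
    show "mixed_cov s t = measure (mixed_measure T) {p. fst p \<le> s \<and> snd p \<le> t}"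
      if "0 \<le> s" "s \<le> T" "0 \<le> t" "t \<le> T" for s t
      using emeasure_mixed_measure[OF that] nn that by (simp add: measure_def)
  qed (use assms AE_mixed_measure in auto)
qed

end

section \<open>Bounds for the covariance and the correction term\<close>

context hurst
begin

text \<open>The exponent \<open>2*H - 2\<close> exceeds -1, so the singularity is integrable, and
  translation invariance makes the value independent of \<open>u\<close>.\<close>

lemma nn_integral_abs_powr_unit:
  "(\<integral>\<^sup>+v. ennreal (\<bar>u - v\<bar> powr (2*H - 2)) * indicator {u-1..u+1} v \<partial>lborel) = ennreal (2 / (2*H - 1))"
proof (rule nn_integral_has_integral_lebesgue')
  define F where "F v = sgn_powr (2*H - 1) (v - u) / (2*H - 1)" for v
  have "((\<lambda>v. \<bar>u - v\<bar> powr (2*H - 2)) has_integral (F (u + 1) - F (u - 1))) {u-1..u+1}"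
  proof (rule fundamental_theorem_of_calculus_interior_strong[of "{u}"])
    fix v assume v: "v \<in> {u-1<..<u+1} - {u}"
    have "((\<lambda>v. sgn_powr (2*H - 1) (v - u)) has_real_derivative (2*H - 1) * \<bar>v - u\<bar> powr (2*H - 1 - 1) * 1) (at v)"
      by (rule DERIV_chain2[where f="sgn_powr (2*H - 1)" and g="\<lambda>v. v - u"], rule DERIV_sgn_powr)
        (use v in \<open>auto intro!: derivative_eq_intros\<close>)
    from DERIV_cdivide[OF this, of "2*H - 1"]
    show "(F has_vector_derivative \<bar>u - v\<bar> powr (2*H - 2)) (at v)"
      using H_gt by (simp add: F_def[abs_def] has_real_derivative_iff_has_vector_derivative abs_minus_commute)
  next
    show "continuous_on {u-1..u+1} F"
      unfolding F_def using H_gt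
      by (intro continuous_on_divide continuous_on_sgn_powr continuous_on_diff continuous_on_id continuous_on_const) auto
  qed auto
  moreover have "F (u + 1) - F (u - 1) = 2 / (2*H - 1)"
    by (simp add: F_def sgn_powr_def diff_divide_distrib[symmetric])
  ultimately show "((\<lambda>v. \<bar>u - v\<bar> powr (2*H - 2)) has_integral 2 / (2*H - 1)) {u-1..u+1}"
    by simp
qed simp

lemma nn_integral_exp_kernel_le:
  assumes "0 < \<theta>" "0 \<le> t"
  shows "(\<integral>\<^sup>+v. ennreal (exp_kernel \<theta> t v) * indicator {0..T} v \<partial>lborel) \<le> ennreal (1 / \<theta>)"
proof -
  have "(\<integral>\<^sup>+v. ennreal (exp_kernel \<theta> t v) * indicator {0..T} v \<partial>lborel) \<le> (\<integral>\<^sup>+v. ennreal (indicator {0..t} v * exp (- \<theta> * (t - v))) \<partial>lborel)"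
    by (intro nn_integral_mono) (auto simp: exp_kernel_def indicator_def)
  also have "\<dots> = ennreal ((1 - exp (- \<theta> * (t - 0))) / \<theta>)"
    using assms exp_integral_right[of 0 t \<theta>] by (subst nn_integral_eq_integral) auto
  also have "\<dots> \<le> ennreal (1 / \<theta>)"
    using assms by (intro ennreal_leI divide_right_mono) auto
  finally show ?thesis .
qed

text \<open>The first summand is the mass of the singular power within distance 1 of the
  singularity, the second bounds the mass of the exponential kernel farther away.\<close>

definition conv_bound :: "real \<Rightarrow> real" where
  "conv_bound \<theta> = 2 / (2*H - 1) + 1 / \<theta>"

lemma conv_bound_pos: "0 < \<theta> \<Longrightarrow> 0 < conv_bound \<theta>"
  using H_gt by (auto simp: conv_bound_def intro!: add_pos_pos)

text \<open>Split at \<open>\<bar>u - v\<bar> = 1\<close>: near the singularity drop the exponential, away from it drop the power.\<close>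

lemma nn_integral_powr_exp_kernel_le:
  assumes "0 < \<theta>" "0 \<le> t"
  shows "(\<integral>\<^sup>+v. ennreal (\<bar>u - v\<bar> powr (2*H - 2) * exp_kernel \<theta> t v) * indicator {0..T} v \<partial>lborel) \<le> ennreal (conv_bound \<theta>)"
proof -
  have "(\<integral>\<^sup>+v. ennreal (\<bar>u - v\<bar> powr (2*H - 2) * exp_kernel \<theta> t v) * indicator {0..T} v \<partial>lborel)
     \<le> (\<integral>\<^sup>+v. ennreal (\<bar>u - v\<bar> powr (2*H - 2)) * indicator {u-1..u+1} v + ennreal (exp_kernel \<theta> t v) * indicator {0..T} v \<partial>lborel)"
  proof (rule nn_integral_mono)
    fix v :: real
    consider "v \<notin> {0..T}" | "v \<in> {0..T}" "v \<in> {u-1..u+1}" | "v \<in> {0..T}" "v \<notin> {u-1..u+1}" by blast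
    then show "ennreal (\<bar>u - v\<bar> powr (2*H - 2) * exp_kernel \<theta> t v) * indicator {0..T} v
      \<le> ennreal (\<bar>u - v\<bar> powr (2*H - 2)) * indicator {u-1..u+1} v + ennreal (exp_kernel \<theta> t v) * indicator {0..T} v"
    proof cases
      case 2
      have "\<bar>u - v\<bar> powr (2*H - 2) * exp_kernel \<theta> t v \<le> \<bar>u - v\<bar> powr (2*H - 2)"
        using exp_kernel_le_1[OF \<open>0 < \<theta>\<close>, of t v] by (intro mult_left_le) auto
      then have "ennreal (\<bar>u - v\<bar> powr (2*H - 2) * exp_kernel \<theta> t v) \<le> ennreal (\<bar>u - v\<bar> powr (2*H - 2))"
        by (rule ennreal_leI)
      with 2 show ?thesis by (simp add: add_increasing2)
    next
      case 3
      then have "1 \<le> \<bar>u - v\<bar>" by auto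
      then have "\<bar>u - v\<bar> powr (2*H - 2) \<le> 1"
        using H_lt powr_mono2'[of "2*H - 2" 1 "\<bar>u - v\<bar>"] by simp
      then have "\<bar>u - v\<bar> powr (2*H - 2) * exp_kernel \<theta> t v \<le> exp_kernel \<theta> t v"
        by (intro mult_left_le_one_le) auto
      then have "ennreal (\<bar>u - v\<bar> powr (2*H - 2) * exp_kernel \<theta> t v) \<le> ennreal (exp_kernel \<theta> t v)"
        by (rule ennreal_leI)
      with 3 show ?thesis by (simp add: add_increasing)
    qed simp
  qed
  also have "\<dots> = (\<integral>\<^sup>+v. ennreal (\<bar>u - v\<bar> powr (2*H - 2)) * indicator {u-1..u+1} v \<partial>lborel) + (\<integral>\<^sup>+v. ennreal (exp_kernel \<theta> t v) * indicator {0..T} v \<partial>lborel)"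
    by (rule nn_integral_add) auto
  also have "\<dots> \<le> ennreal (2 / (2*H - 1)) + ennreal (1 / \<theta>)"
    unfolding nn_integral_abs_powr_unit
    by (intro add_left_mono nn_integral_exp_kernel_le assms)
  also have "\<dots> = ennreal (conv_bound \<theta>)"
    using assms H_gt by (simp add: conv_bound_def ennreal_plus)
  finally show ?thesis .
qed

text \<open>The first summand comes from the diagonal part of the measure. The second comes from the
  density: integrating in \<open>v\<close> costs \<open>alpha_H H * conv_bound \<theta>\<close>,
  then integrating in \<open>u\<close> costs \<open>1 / \<theta>\<close>.\<close>

definition var_bound :: "real \<Rightarrow> real" where
  "var_bound \<theta> = 1 / \<theta> + alpha_H H * conv_bound \<theta> * (1 / \<theta>)"

lemma cov_le_var_bound:
  assumes "0 < \<theta>" "0 \<le> t" "0 \<le> T" "0 \<le> s"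
  shows "covariance_measure.cov (mixed_measure T) \<theta> s t \<le> var_bound \<theta>"
proof -
  interpret covariance_measure "mixed_measure T" \<theta> T mixed_cov
    using assms by (intro mixed_covariance_measure)
  have "ennreal (cov s t) = (\<integral>\<^sup>+p. ennreal (exp_kernel \<theta> s (fst p)) * ennreal (exp_kernel \<theta> t (snd p)) \<partial>mixed_measure T)"
    by (rule ennreal_cov)
  also have "\<dots> = (\<integral>\<^sup>+u. (ennreal (exp_kernel \<theta> s u) * ennreal (exp_kernel \<theta> t u)) * indicator {0..T} u \<partial>lborel)
     + (\<integral>\<^sup>+u. (\<integral>\<^sup>+v. ennreal (alpha_H H * sfbm_kernel u v) * indicator {0..T} v * (ennreal (exp_kernel \<theta> s u) * ennreal (exp_kernel \<theta> t v)) \<partial>lborel) * indicator {0..T} u \<partial>lborel)"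
    by (subst nn_integral_mixed_measure) auto
  also have "\<dots> \<le> ennreal (1 / \<theta>) + ennreal (alpha_H H * conv_bound \<theta>) * ennreal (1 / \<theta>)"
  proof (rule add_mono)
    have "(\<integral>\<^sup>+u. (ennreal (exp_kernel \<theta> s u) * ennreal (exp_kernel \<theta> t u)) * indicator {0..T} u \<partial>lborel)
      \<le> (\<integral>\<^sup>+u. ennreal (exp_kernel \<theta> s u) * indicator {0..T} u \<partial>lborel)"
    proof (intro nn_integral_mono mult_right_mono)
      fix u
      have "ennreal (exp_kernel \<theta> s u) * ennreal (exp_kernel \<theta> t u) \<le> ennreal (exp_kernel \<theta> s u) * 1"
        using exp_kernel_le_1[OF \<open>0 < \<theta>\<close>, of t u] by (intro mult_left_mono) auto
      then show "ennreal (exp_kernel \<theta> s u) * ennreal (exp_kernel \<theta> t u) \<le> ennreal (exp_kernel \<theta> s u)" by simp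
    qed auto
    also have "\<dots> \<le> ennreal (1 / \<theta>)" by (rule nn_integral_exp_kernel_le) fact+
    finally show "(\<integral>\<^sup>+u. (ennreal (exp_kernel \<theta> s u) * ennreal (exp_kernel \<theta> t u)) * indicator {0..T} u \<partial>lborel) \<le> ennreal (1 / \<theta>)" .
    have "(\<integral>\<^sup>+u. (\<integral>\<^sup>+v. ennreal (alpha_H H * sfbm_kernel u v) * indicator {0..T} v * (ennreal (exp_kernel \<theta> s u) * ennreal (exp_kernel \<theta> t v)) \<partial>lborel) * indicator {0..T} u \<partial>lborel)
      \<le> (\<integral>\<^sup>+u. ennreal (alpha_H H * conv_bound \<theta>) * (ennreal (exp_kernel \<theta> s u) * indicator {0..T} u) \<partial>lborel)"
    proof (rule nn_integral_mono)
      fix u :: real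
      have "(\<integral>\<^sup>+v. ennreal (alpha_H H * sfbm_kernel u v) * indicator {0..T} v * (ennreal (exp_kernel \<theta> s u) * ennreal (exp_kernel \<theta> t v)) \<partial>lborel)
        \<le> (\<integral>\<^sup>+v. (ennreal (alpha_H H) * ennreal (exp_kernel \<theta> s u)) * (ennreal (\<bar>u - v\<bar> powr (2*H - 2) * exp_kernel \<theta> t v) * indicator {0..T} v) \<partial>lborel)"
      proof (rule nn_integral_mono)
        fix v
        \<comment> \<open>The subtracted power of \<open>u + v\<close> is dropped; for an upper
          bound only the singular power counts.\<close>
        have "ennreal (alpha_H H * sfbm_kernel u v) \<le> ennreal (alpha_H H) * ennreal (\<bar>u - v\<bar> powr (2*H - 2))"
          using alpha_pos sfbm_kernel_le[of u v] by (simp flip: ennreal_mult)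
        then have "ennreal (alpha_H H * sfbm_kernel u v) * (indicator {0..T} v * (ennreal (exp_kernel \<theta> s u) * ennreal (exp_kernel \<theta> t v)))
          \<le> ennreal (alpha_H H) * ennreal (\<bar>u - v\<bar> powr (2*H - 2)) * (indicator {0..T} v * (ennreal (exp_kernel \<theta> s u) * ennreal (exp_kernel \<theta> t v)))"
          by (rule mult_right_mono) simp
        then show "ennreal (alpha_H H * sfbm_kernel u v) * indicator {0..T} v * (ennreal (exp_kernel \<theta> s u) * ennreal (exp_kernel \<theta> t v))
           \<le> (ennreal (alpha_H H) * ennreal (exp_kernel \<theta> s u)) * (ennreal (\<bar>u - v\<bar> powr (2*H - 2) * exp_kernel \<theta> t v) * indicator {0..T} v)"
          by (simp add: ennreal_mult ac_simps)
      qed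
      also have "\<dots> = ennreal (alpha_H H) * ennreal (exp_kernel \<theta> s u) * (\<integral>\<^sup>+v. ennreal (\<bar>u - v\<bar> powr (2*H - 2) * exp_kernel \<theta> t v) * indicator {0..T} v \<partial>lborel)"
        by (rule nn_integral_cmult) simp
      also have "\<dots> \<le> ennreal (alpha_H H) * ennreal (exp_kernel \<theta> s u) * ennreal (conv_bound \<theta>)"
        by (intro mult_left_mono nn_integral_powr_exp_kernel_le assms) simp
      also have "\<dots> = ennreal (alpha_H H * conv_bound \<theta>) * ennreal (exp_kernel \<theta> s u)"
        using alpha_pos conv_bound_pos[OF \<open>0 < \<theta>\<close>] by (simp add: ennreal_mult ac_simps)
      finally show "(\<integral>\<^sup>+v. ennreal (alpha_H H * sfbm_kernel u v) * indicator {0..T} v * (ennreal (exp_kernel \<theta> s u) * ennreal (exp_kernel \<theta> t v)) \<partial>lborel) * indicator {0..T} u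
         \<le> ennreal (alpha_H H * conv_bound \<theta>) * (ennreal (exp_kernel \<theta> s u) * indicator {0..T} u)"
        unfolding mult.assoc[symmetric] by (rule mult_right_mono) simp
    qed
    also have "\<dots> = ennreal (alpha_H H * conv_bound \<theta>) * (\<integral>\<^sup>+u. ennreal (exp_kernel \<theta> s u) * indicator {0..T} u \<partial>lborel)"
      by (rule nn_integral_cmult) simp
    also have "\<dots> \<le> ennreal (alpha_H H * conv_bound \<theta>) * ennreal (1 / \<theta>)"
      by (intro mult_left_mono nn_integral_exp_kernel_le assms) simp
    finally show "(\<integral>\<^sup>+u. (\<integral>\<^sup>+v. ennreal (alpha_H H * sfbm_kernel u v) * indicator {0..T} v * (ennreal (exp_kernel \<theta> s u) * ennreal (exp_kernel \<theta> t v)) \<partial>lborel) * indicator {0..T} u \<partial>lborel)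
       \<le> ennreal (alpha_H H * conv_bound \<theta>) * ennreal (1 / \<theta>)" .
  qed
  also have "\<dots> = ennreal (var_bound \<theta>)"
  proof -
    have "0 \<le> alpha_H H * conv_bound \<theta>" "0 \<le> 1 / \<theta>"
      using alpha_pos conv_bound_pos[OF \<open>0 < \<theta>\<close>] \<open>0 < \<theta>\<close> by auto
    then show ?thesis
      unfolding var_bound_def by (simp only: ennreal_plus mult_nonneg_nonneg ennreal_mult)
  qed
  finally have "ennreal (cov s t) \<le> ennreal (var_bound \<theta>)" .
  moreover have "0 \<le> var_bound \<theta>"
    unfolding var_bound_def using alpha_pos conv_bound_pos[OF \<open>0 < \<theta>\<close>] \<open>0 < \<theta>\<close> by simp
  ultimately show ?thesis by (simp add: ennreal_le_iff)
qed

section \<open>The two halves of the correction term\<close>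

definition diff_part :: "real \<Rightarrow> real \<Rightarrow> real" where
  "diff_part \<theta> t = (\<integral>s. indicator {0..t} s * (exp (- \<theta> * (t - s)) * (t - s) powr (2*H - 2)) \<partial>lborel)"

text \<open>Together with \<open>diff_part\<close> this splits the inner integral of the correction
  term. The estimator adds the two parts, the energy identity subtracts them.\<close>

definition sum_part :: "real \<Rightarrow> real \<Rightarrow> real" where
  "sum_part \<theta> t = (\<integral>s. indicator {0..t} s * (exp (- \<theta> * (t - s)) * (t + s) powr (2*H - 2)) \<partial>lborel)"

lemma diff_part_measurable [measurable]: "diff_part \<theta> \<in> borel_measurable borel"
  unfolding diff_part_def indicator_def atLeastAtMost_iff by measurable

lemma sum_part_measurable [measurable]: "sum_part \<theta> \<in> borel_measurable borel"
  unfolding sum_part_def indicator_def atLeastAtMost_iff by measurable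

lemma diff_part:
  assumes "0 < \<theta>" "0 \<le> t"
  shows "integrable lborel (\<lambda>s. indicator {0..t} s * (exp (- \<theta> * (t - s)) * (t - s) powr (2*H - 2)))"
    and "0 \<le> diff_part \<theta> t" "diff_part \<theta> t \<le> conv_bound \<theta>"
proof -
  have "(\<integral>\<^sup>+s. ennreal (indicator {0..t} s * (exp (- \<theta> * (t - s)) * (t - s) powr (2*H - 2))) \<partial>lborel)
     = (\<integral>\<^sup>+v. ennreal (\<bar>t - v\<bar> powr (2*H - 2) * exp_kernel \<theta> t v) * indicator {0..t} v \<partial>lborel)"
    by (intro nn_integral_cong) (auto simp: exp_kernel_def indicator_def mult.commute)
  also have "\<dots> \<le> ennreal (conv_bound \<theta>)"
    using assms by (intro nn_integral_powr_exp_kernel_le)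
  finally have le: "(\<integral>\<^sup>+s. ennreal (indicator {0..t} s * (exp (- \<theta> * (t - s)) * (t - s) powr (2*H - 2))) \<partial>lborel) \<le> ennreal (conv_bound \<theta>)" .
  show "integrable lborel (\<lambda>s. indicator {0..t} s * (exp (- \<theta> * (t - s)) * (t - s) powr (2*H - 2)))"
    by (rule integrableI_nonneg) (use le_less_trans[OF le ennreal_less_top] in auto)
  have eq: "diff_part \<theta> t = enn2real (\<integral>\<^sup>+s. ennreal (indicator {0..t} s * (exp (- \<theta> * (t - s)) * (t - s) powr (2*H - 2))) \<partial>lborel)"
    unfolding diff_part_def by (rule integral_eq_nn_integral) auto
  show "0 \<le> diff_part \<theta> t" unfolding eq by simp
  show "diff_part \<theta> t \<le> conv_bound \<theta>"
    unfolding eq using le conv_bound_pos[OF \<open>0 < \<theta>\<close>] by (intro enn2real_leI) auto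
qed

text \<open>On \<open>[0, t]\<close> the base \<open>t + s\<close> is at least \<open>t\<close>, so
  the power can be pulled out as \<open>t powr (2*H - 2)\<close>.\<close>

lemma sum_part:
  assumes "0 < \<theta>" "0 < t"
  shows "integrable lborel (\<lambda>s. indicator {0..t} s * (exp (- \<theta> * (t - s)) * (t + s) powr (2*H - 2)))"
    and "0 \<le> sum_part \<theta> t" "sum_part \<theta> t \<le> t powr (2*H - 2) / \<theta>"
proof -
  have i: "integrable lborel (\<lambda>s. indicator {0..t} s * exp (- \<theta> * (t - s)) * t powr (2*H - 2))"
    using assms by (intro integrable_mult_left exp_integral_right) auto
  have le: "indicator {0..t} s * (exp (- \<theta> * (t - s)) * (t + s) powr (2*H - 2)) \<le> indicator {0..t} s * exp (- \<theta> * (t - s)) * t powr (2*H - 2)" for s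
    using assms H_lt by (auto simp: indicator_def intro!: powr_mono2')
  show *: "integrable lborel (\<lambda>s. indicator {0..t} s * (exp (- \<theta> * (t - s)) * (t + s) powr (2*H - 2)))"
    by (rule Bochner_Integration.integrable_bound[OF i]) (use le in auto)
  show "0 \<le> sum_part \<theta> t" unfolding sum_part_def by (rule integral_nonneg_AE) auto
  have "sum_part \<theta> t \<le> (\<integral>s. indicator {0..t} s * exp (- \<theta> * (t - s)) * t powr (2*H - 2) \<partial>lborel)"
    unfolding sum_part_def using * i le by (intro integral_mono) auto
  also have "\<dots> = (1 - exp (- \<theta> * (t - 0))) / \<theta> * t powr (2*H - 2)"
    using exp_integral_right(2)[of 0 t \<theta>] assms by (subst integral_mult_left_zero) simp
  also have "\<dots> \<le> 1 / \<theta> * t powr (2*H - 2)"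
    using assms by (intro mult_right_mono divide_right_mono) auto
  finally show "sum_part \<theta> t \<le> t powr (2*H - 2) / \<theta>" by simp
qed

lemma powr_integral:
  assumes "0 \<le> T"
  shows "integrable lborel (\<lambda>t. indicator {0..T} t * t powr (2*H - 2))"
    and "(\<integral>t. indicator {0..T} t * t powr (2*H - 2) \<partial>lborel) = T powr (2*H - 1) / (2*H - 1)"
proof -
  have "((\<lambda>t. t powr (2*H - 2)) has_integral (T powr (2*H - 1) / (2*H - 1) - 0 powr (2*H - 1) / (2*H - 1))) {0..T}"
  proof (rule fundamental_theorem_of_calculus_interior_strong[of "{}"])
    fix t assume t: "t \<in> {0<..<T} - {}"
    have "((\<lambda>t. t powr (2*H - 1)) has_real_derivative (2*H - 1) * t powr (2*H - 1 - 1)) (at t)"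
      using t by (auto intro!: derivative_eq_intros)
    from DERIV_cdivide[OF this, of "2*H - 1"]
    show "((\<lambda>t. t powr (2*H - 1) / (2*H - 1)) has_vector_derivative t powr (2*H - 2)) (at t)"
      using H_gt by (simp add: has_real_derivative_iff_has_vector_derivative)
  next
    show "continuous_on {0..T} (\<lambda>t. t powr (2*H - 1) / (2*H - 1))"
      using H_gt by (intro continuous_on_divide continuous_on_powr' continuous_on_id continuous_on_const) auto
  qed (use assms in auto)
  then have "(\<integral>\<^sup>+t. ennreal (t powr (2*H - 2)) * indicator {0..T} t \<partial>lborel) = ennreal (T powr (2*H - 1) / (2*H - 1))"
    by (intro nn_integral_has_integral_lebesgue') auto
  then have "(\<integral>\<^sup>+t. ennreal (indicator {0..T} t * t powr (2*H - 2)) \<partial>lborel) = ennreal (T powr (2*H - 1) / (2*H - 1))"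
    by (simp add: ennreal_mult' ennreal_indicator mult.commute)
  then have "has_bochner_integral lborel (\<lambda>t. indicator {0..T} t * t powr (2*H - 2)) (T powr (2*H - 1) / (2*H - 1))"
    using H_gt by (intro has_bochner_integral_nn_integral) auto
  then show "integrable lborel (\<lambda>t. indicator {0..T} t * t powr (2*H - 2))"
    "(\<integral>t. indicator {0..T} t * t powr (2*H - 2) \<partial>lborel) = T powr (2*H - 1) / (2*H - 1)"
    by (auto simp: has_bochner_integral_iff)
qed

lemma diff_part_minus_sum_part:
  assumes "0 < \<theta>" "0 < u"
  shows "0 \<le> diff_part \<theta> u - sum_part \<theta> u"
    and "(\<integral>\<^sup>+v. ennreal (alpha_H H * sfbm_kernel u v * exp (- \<theta> * \<bar>u - v\<bar>)) * indicator {0..u} v \<partial>lborel)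
      = ennreal (alpha_H H * (diff_part \<theta> u - sum_part \<theta> u))"
proof -
  define f where "f v = indicator {0..u} v * (exp (- \<theta> * (u - v)) * (u - v) powr (2*H - 2))
     - indicator {0..u} v * (exp (- \<theta> * (u - v)) * (u + v) powr (2*H - 2))" for v
  have f: "integrable lborel f" "integral\<^sup>L lborel f = diff_part \<theta> u - sum_part \<theta> u"
    using diff_part(1)[of \<theta> u] sum_part(1)[of \<theta> u] assms
    by (auto simp: f_def[abs_def] diff_part_def sum_part_def)
  \<comment> \<open>The point \<open>v = u\<close> is left out: the kernel is 0 there by definition,
    while \<open>f\<close> takes the value \<open>- ((2*u) powr (2*H - 2))\<close>.\<close>
  have f_eq: "f v = sfbm_kernel u v * exp (- \<theta> * \<bar>u - v\<bar>) * indicator {0..u} v" if "v \<noteq> u" for v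
    using that by (auto simp: f_def sfbm_kernel_def indicator_def algebra_simps)
  have ae: "AE v in lborel. v \<noteq> u" by (rule AE_lborel_singleton)
  have nn: "AE v in lborel. 0 \<le> f v"
    using ae by eventually_elim (use assms in \<open>auto simp: f_eq indicator_def sfbm_kernel_nonneg\<close>)
  show "0 \<le> diff_part \<theta> u - sum_part \<theta> u"
    unfolding f(2)[symmetric] by (rule integral_nonneg_AE[OF nn])
  have "(\<integral>\<^sup>+v. ennreal (alpha_H H * sfbm_kernel u v * exp (- \<theta> * \<bar>u - v\<bar>)) * indicator {0..u} v \<partial>lborel)
     = (\<integral>\<^sup>+v. ennreal (alpha_H H * f v) \<partial>lborel)"
    using ae by (intro nn_integral_cong_AE, eventually_elim) (auto simp: f_eq indicator_def mult.assoc)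
  also have "\<dots> = ennreal (alpha_H H * (diff_part \<theta> u - sum_part \<theta> u))"
    using f nn alpha_pos by (subst nn_integral_eq_integral) auto
  finally show "(\<integral>\<^sup>+v. ennreal (alpha_H H * sfbm_kernel u v * exp (- \<theta> * \<bar>u - v\<bar>)) * indicator {0..u} v \<partial>lborel)
      = ennreal (alpha_H H * (diff_part \<theta> u - sum_part \<theta> u))" .
qed

lemma diff_part_integrable:
  assumes "0 < \<theta>" "0 \<le> T"
  shows "integrable lborel (\<lambda>t. indicator {0..T} t * diff_part \<theta> t)"
proof (rule Bochner_Integration.integrable_bound[where f="\<lambda>t. indicator {0..T} t * conv_bound \<theta>"])
  show "integrable lborel (\<lambda>t. indicator {0..T} t * conv_bound \<theta>)"
    by (intro integrable_mult_left integrable_real_indicator) (auto simp: emeasure_lborel_Icc_eq)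
  show "AE t in lborel. norm (indicator {0..T} t * diff_part \<theta> t) \<le> norm (indicator {0..T} t * conv_bound \<theta>)"
    using diff_part(2,3)[OF \<open>0 < \<theta>\<close>] by (intro AE_I2) (auto simp: indicator_def intro: order_trans[OF _ abs_ge_self])
qed simp

text \<open>The pointwise bound holds away from the null set \<open>t = 0\<close>. Integrating it
  gives the rate \<open>T powr (2*H - 1)\<close>, of smaller order than \<open>T\<close> since
  \<open>H < 1\<close>.\<close>

lemma sum_part_integrable:
  assumes "0 < \<theta>" "0 \<le> T"
  shows "integrable lborel (\<lambda>t. indicator {0..T} t * sum_part \<theta> t)"
    and "0 \<le> (\<integral>t. indicator {0..T} t * sum_part \<theta> t \<partial>lborel)"
    and "(\<integral>t. indicator {0..T} t * sum_part \<theta> t \<partial>lborel) \<le> T powr (2*H - 1) / ((2*H - 1) * \<theta>)"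
proof -
  have nz: "AE t in lborel. t \<noteq> (0::real)" by (rule AE_lborel_singleton)
  have i: "integrable lborel (\<lambda>t. indicator {0..T} t * t powr (2*H - 2) / \<theta>)"
    using powr_integral(1)[OF \<open>0 \<le> T\<close>] by simp
  have nn: "AE t in lborel. 0 \<le> indicator {0..T} t * sum_part \<theta> t"
    using nz by eventually_elim (use sum_part(2)[OF \<open>0 < \<theta>\<close>] in \<open>auto simp: indicator_def\<close>)
  have le: "AE t in lborel. indicator {0..T} t * sum_part \<theta> t \<le> indicator {0..T} t * t powr (2*H - 2) / \<theta>"
    using nz by eventually_elim (use sum_part(3)[OF \<open>0 < \<theta>\<close>] in \<open>auto simp: indicator_def\<close>)
  show int: "integrable lborel (\<lambda>t. indicator {0..T} t * sum_part \<theta> t)"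
    by (rule Bochner_Integration.integrable_bound[OF i])
      (use nn le in \<open>simp, eventually_elim, use assms in auto\<close>)
  show "0 \<le> (\<integral>t. indicator {0..T} t * sum_part \<theta> t \<partial>lborel)"
    by (rule integral_nonneg_AE[OF nn])
  have "(\<integral>t. indicator {0..T} t * sum_part \<theta> t \<partial>lborel) \<le> (\<integral>t. indicator {0..T} t * t powr (2*H - 2) / \<theta> \<partial>lborel)"
    by (rule integral_mono_AE[OF int i le])
  also have "\<dots> = T powr (2*H - 1) / ((2*H - 1) * \<theta>)"
    using powr_integral(2)[OF \<open>0 \<le> T\<close>] by simp
  finally show "(\<integral>t. indicator {0..T} t * sum_part \<theta> t \<partial>lborel) \<le> T powr (2*H - 1) / ((2*H - 1) * \<theta>)" .
qed

text \<open>On the diagonal the exponential is 1, which contributes \<open>T\<close>. The density is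
  symmetric, so it contributes twice its integral over the triangle \<open>v \<le> u\<close>, where
  the inner integral is \<open>alpha_H H * (diff_part \<theta> u - sum_part \<theta> u)\<close>.
  That this difference is nonnegative for positive \<open>u\<close> gives the lower bound.\<close>

lemma exp_integral_mixed_measure:
  assumes "0 < \<theta>" "0 \<le> T"
  shows "(\<integral>p. exp (- \<theta> * \<bar>fst p - snd p\<bar>) \<partial>mixed_measure T)
    = T + 2 * alpha_H H * (\<integral>t. indicator {0..T} t * (diff_part \<theta> t - sum_part \<theta> t) \<partial>lborel)"
    and "T \<le> (\<integral>p. exp (- \<theta> * \<bar>fst p - snd p\<bar>) \<partial>mixed_measure T)"
proof -
  define g where "g u v = ennreal (alpha_H H * sfbm_kernel u v * exp (- \<theta> * \<bar>u - v\<bar>))" for u v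
  have g_commute: "g u v = g v u" for u v
    by (simp add: g_def sfbm_kernel_commute abs_minus_commute)
  have [measurable]: "(\<lambda>(u, v). g u v) \<in> borel_measurable (borel \<Otimes>\<^sub>M borel)"
    unfolding g_def by measurable
  have [measurable (raw)]: "(\<lambda>x. g (f1 x) (f2 x)) \<in> borel_measurable N"
    if "f1 \<in> borel_measurable N" "f2 \<in> borel_measurable N" for f1 f2 and N :: "'c measure"
    using that unfolding g_def by measurable
  have nz: "AE t in lborel. t \<noteq> (0::real)" by (rule AE_lborel_singleton)
  define A where "A = (\<integral>t. indicator {0..T} t * (diff_part \<theta> t - sum_part \<theta> t) \<partial>lborel)"
  have iA: "integrable lborel (\<lambda>t. indicator {0..T} t * (diff_part \<theta> t - sum_part \<theta> t))"
    using diff_part_integrable[OF assms] sum_part_integrable(1)[OF assms] by (simp add: right_diff_distrib)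
  have nnA: "AE t in lborel. 0 \<le> indicator {0..T} t * (diff_part \<theta> t - sum_part \<theta> t)"
    using nz by eventually_elim (use diff_part_minus_sum_part(1)[OF \<open>0 < \<theta>\<close>] in \<open>auto simp: indicator_def\<close>)
  have A_nonneg: "0 \<le> A" unfolding A_def by (rule integral_nonneg_AE[OF nnA])
  \<comment> \<open>Both triangles will contain the diagonal; counting it twice is harmless because
    the kernel vanishes there.\<close>
  define L where "L = (\<lambda>(u, v). g u v * indicator {0..T} v * indicator {0..T} u * indicator {..u} v)"
  have [measurable]: "L \<in> borel_measurable (lborel \<Otimes>\<^sub>M lborel)"
    unfolding L_def indicator_def atLeastAtMost_iff atMost_iff by measurable
  have lower: "(\<integral>\<^sup>+u. (\<integral>\<^sup>+v. L (u, v) \<partial>lborel) \<partial>lborel) = ennreal (alpha_H H * A)"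
  proof -
    have "(\<integral>\<^sup>+u. (\<integral>\<^sup>+v. L (u, v) \<partial>lborel) \<partial>lborel) = (\<integral>\<^sup>+t. ennreal (alpha_H H * (indicator {0..T} t * (diff_part \<theta> t - sum_part \<theta> t))) \<partial>lborel)"
      using nz
    proof (intro nn_integral_cong_AE, eventually_elim)
      fix u :: real assume "u \<noteq> 0"
      show "(\<integral>\<^sup>+v. L (u, v) \<partial>lborel) = ennreal (alpha_H H * (indicator {0..T} u * (diff_part \<theta> u - sum_part \<theta> u)))"
      proof (cases "u \<in> {0..T}")
        case True
        have "(\<integral>\<^sup>+v. L (u, v) \<partial>lborel) = (\<integral>\<^sup>+v. g u v * indicator {0..u} v \<partial>lborel)"
          using True by (intro nn_integral_cong) (auto simp: L_def indicator_def)
        also have "\<dots> = ennreal (alpha_H H * (diff_part \<theta> u - sum_part \<theta> u))"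
          unfolding g_def using True \<open>u \<noteq> 0\<close> assms by (intro diff_part_minus_sum_part) auto
        finally show ?thesis using True by simp
      qed (simp add: L_def)
    qed
    also have "\<dots> = ennreal (alpha_H H * A)"
      unfolding A_def using iA nnA alpha_pos by (subst nn_integral_eq_integral) auto
    finally show ?thesis .
  qed
  have upper: "(\<integral>\<^sup>+u. (\<integral>\<^sup>+v. L (v, u) \<partial>lborel) \<partial>lborel) = ennreal (alpha_H H * A)"
    unfolding lower[symmetric] by (subst lborel_pair.Fubini') auto
  have "(\<integral>\<^sup>+p. ennreal (exp (- \<theta> * \<bar>fst p - snd p\<bar>)) \<partial>mixed_measure T)
     = (\<integral>\<^sup>+u. ennreal (exp (- \<theta> * \<bar>u - u\<bar>)) * indicator {0..T} u \<partial>lborel)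
     + (\<integral>\<^sup>+u. (\<integral>\<^sup>+v. ennreal (alpha_H H * sfbm_kernel u v) * indicator {0..T} v * ennreal (exp (- \<theta> * \<bar>u - v\<bar>)) \<partial>lborel) * indicator {0..T} u \<partial>lborel)"
    by (subst nn_integral_mixed_measure) auto
  also have "(\<integral>\<^sup>+u. ennreal (exp (- \<theta> * \<bar>u - u\<bar>)) * indicator {0..T} u \<partial>lborel) = ennreal T"
    using assms by simp
  also have "(\<integral>\<^sup>+u. (\<integral>\<^sup>+v. ennreal (alpha_H H * sfbm_kernel u v) * indicator {0..T} v * ennreal (exp (- \<theta> * \<bar>u - v\<bar>)) \<partial>lborel) * indicator {0..T} u \<partial>lborel)
      = (\<integral>\<^sup>+u. (\<integral>\<^sup>+v. L (u, v) \<partial>lborel) + (\<integral>\<^sup>+v. L (v, u) \<partial>lborel) \<partial>lborel)"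
  proof (rule nn_integral_cong)
    fix u :: real
    have "(\<integral>\<^sup>+v. ennreal (alpha_H H * sfbm_kernel u v) * indicator {0..T} v * ennreal (exp (- \<theta> * \<bar>u - v\<bar>)) \<partial>lborel) * indicator {0..T} u
      = (\<integral>\<^sup>+v. (ennreal (alpha_H H * sfbm_kernel u v) * indicator {0..T} v * ennreal (exp (- \<theta> * \<bar>u - v\<bar>))) * indicator {0..T} u \<partial>lborel)"
      by (rule nn_integral_multc[symmetric]) simp
    also have "\<dots> = (\<integral>\<^sup>+v. L (u, v) + L (v, u) \<partial>lborel)"
    proof (rule nn_integral_cong)
      fix v
      have "ennreal (alpha_H H * sfbm_kernel u v) * ennreal (exp (- \<theta> * \<bar>u - v\<bar>)) = g u v"
        unfolding g_def by (simp add: ennreal_mult'')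
      moreover have "g u v = 0" if "u = v" using that by (simp add: g_def sfbm_kernel_def)
      ultimately show "ennreal (alpha_H H * sfbm_kernel u v) * indicator {0..T} v * ennreal (exp (- \<theta> * \<bar>u - v\<bar>)) * indicator {0..T} u = L (u, v) + L (v, u)"
        using g_commute[of u v] by (auto simp: L_def indicator_def)
    qed
    also have "\<dots> = (\<integral>\<^sup>+v. L (u, v) \<partial>lborel) + (\<integral>\<^sup>+v. L (v, u) \<partial>lborel)"
      by (rule nn_integral_add) simp_all
    finally show "(\<integral>\<^sup>+v. ennreal (alpha_H H * sfbm_kernel u v) * indicator {0..T} v * ennreal (exp (- \<theta> * \<bar>u - v\<bar>)) \<partial>lborel) * indicator {0..T} u
      = (\<integral>\<^sup>+v. L (u, v) \<partial>lborel) + (\<integral>\<^sup>+v. L (v, u) \<partial>lborel)" .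
  qed
  also have "\<dots> = ennreal (alpha_H H * A) + ennreal (alpha_H H * A)"
    unfolding lower[symmetric] by (subst nn_integral_add) (auto simp: upper lower)
  also have "ennreal T + \<dots> = ennreal (T + 2 * alpha_H H * A)"
    using assms alpha_pos A_nonneg by (simp flip: ennreal_plus)
  finally have nn: "(\<integral>\<^sup>+p. ennreal (exp (- \<theta> * \<bar>fst p - snd p\<bar>)) \<partial>mixed_measure T) = ennreal (T + 2 * alpha_H H * A)" .
  have "(\<integral>p. exp (- \<theta> * \<bar>fst p - snd p\<bar>) \<partial>mixed_measure T)
      = enn2real (\<integral>\<^sup>+p. ennreal (exp (- \<theta> * \<bar>fst p - snd p\<bar>)) \<partial>mixed_measure T)"
    by (rule integral_eq_nn_integral) auto
  also have "\<dots> = T + 2 * alpha_H H * A"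
    unfolding nn using assms alpha_pos A_nonneg by (intro enn2real_ennreal) simp
  finally show "(\<integral>p. exp (- \<theta> * \<bar>fst p - snd p\<bar>) \<partial>mixed_measure T)
    = T + 2 * alpha_H H * (\<integral>t. indicator {0..T} t * (diff_part \<theta> t - sum_part \<theta> t) \<partial>lborel)"
    "T \<le> (\<integral>p. exp (- \<theta> * \<bar>fst p - snd p\<bar>) \<partial>mixed_measure T)"
    using alpha_pos A_nonneg by (auto simp: A_def)
qed

lemma corr_term_eq:
  assumes "0 < \<theta>" "0 \<le> T"
  shows "corr_term \<theta> H T = (\<integral>t. indicator {0..T} t * (diff_part \<theta> t + sum_part \<theta> t) \<partial>lborel)"
proof -
  define G where "G t = (LBINT s=0..t. exp (- \<theta> * (t - s)) * ((t - s) powr (2*H - 2) + (t + s) powr (2*H - 2)))" for t :: real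
  have G: "G t = diff_part \<theta> t + sum_part \<theta> t" if "0 < t" for t
  proof -
    have "G t = (\<integral>s. indicator {0..t} s * (exp (- \<theta> * (t - s)) * ((t - s) powr (2*H - 2) + (t + s) powr (2*H - 2))) \<partial>lborel)"
      using interval_integral_Icc[of 0 t "\<lambda>s. exp (- \<theta> * (t - s)) * ((t - s) powr (2*H - 2) + (t + s) powr (2*H - 2))"] that
      by (simp add: G_def set_lebesgue_integral_def zero_ereal_def)
    also have "\<dots> = diff_part \<theta> t + sum_part \<theta> t"
      unfolding diff_part_def sum_part_def
      using diff_part(1)[of \<theta> t] sum_part(1)[of \<theta> t] that assms
      by (subst Bochner_Integration.integral_add[symmetric]) (auto simp: algebra_simps)
    finally show ?thesis .
  qed
  \<comment> \<open>The point \<open>t = 0\<close> is left out because \<open>G\<close> is split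
    only at positive times; it returns below as a null set.\<close>
  have "corr_term \<theta> H T = (LBINT t:{0<..T}. G t)"
    unfolding corr_term_def G_def[symmetric]
    using interval_integral_Ioc[of 0 T G] assms by (simp add: zero_ereal_def)
  also have "\<dots> = (\<integral>t. indicator {0<..T} t * (diff_part \<theta> t + sum_part \<theta> t) \<partial>lborel)"
    unfolding set_lebesgue_integral_def by (intro Bochner_Integration.integral_cong) (auto simp: indicator_def G)
  also have "\<dots> = (\<integral>t. indicator {0..T} t * (diff_part \<theta> t + sum_part \<theta> t) \<partial>lborel)"
    using AE_lborel_singleton[of 0] by (intro integral_cong_AE) (auto simp: indicator_def)
  finally show ?thesis .
qed

text \<open>With \<open>P\<close> and \<open>Q\<close> the time integrals of
  \<open>diff_part\<close> and \<open>sum_part\<close>, the estimator contains \<open>P + Q\<close>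
  and the energy identity \<open>P - Q\<close>. The gap is \<open>2 * alpha_H H * Q\<close>, and
  only the nonsingular part \<open>Q\<close> has to be small.\<close>

lemma corr_term_bound:
  assumes "0 < \<theta>" "0 \<le> T"
  shows "\<bar>alpha_H H * corr_term \<theta> H T - ((\<integral>p. exp (- \<theta> * \<bar>fst p - snd p\<bar>) \<partial>mixed_measure T) - T) / 2\<bar>
    \<le> 2 * alpha_H H * (T powr (2*H - 1) / ((2*H - 1) * \<theta>))"
proof -
  define P where "P = (\<integral>t. indicator {0..T} t * diff_part \<theta> t \<partial>lborel)"
  define Q where "Q = (\<integral>t. indicator {0..T} t * sum_part \<theta> t \<partial>lborel)"
  note i = diff_part_integrable[OF assms] sum_part_integrable(1)[OF assms]
  have c: "corr_term \<theta> H T = P + Q"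
    unfolding corr_term_eq[OF assms] P_def Q_def using i by (simp add: distrib_left)
  have e: "(\<integral>p. exp (- \<theta> * \<bar>fst p - snd p\<bar>) \<partial>mixed_measure T) = T + 2 * alpha_H H * (P - Q)"
    unfolding exp_integral_mixed_measure(1)[OF assms] P_def Q_def using i by (simp add: right_diff_distrib)
  have "\<bar>alpha_H H * corr_term \<theta> H T - ((\<integral>p. exp (- \<theta> * \<bar>fst p - snd p\<bar>) \<partial>mixed_measure T) - T) / 2\<bar> = \<bar>2 * alpha_H H * Q\<bar>"
    unfolding c e by (simp add: field_simps)
  also have "\<dots> = 2 * alpha_H H * Q"
    using alpha_pos sum_part_integrable(2)[OF assms] by (simp add: Q_def)
  also have "\<dots> \<le> 2 * alpha_H H * (T powr (2*H - 1) / ((2*H - 1) * \<theta>))"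
    unfolding Q_def using alpha_pos by (intro mult_left_mono sum_part_integrable assms) auto
  finally show ?thesis .
qed

lemma mixed_cov_diag: "0 \<le> T \<Longrightarrow> mixed_cov T T = T + (2 - 2 powr (2*H) / 2) * T powr (2*H)"
  using powr_mult[of 2 T "2*H"] by (simp add: mixed_cov_def subfBm_cov_def algebra_simps)

end

section \<open>Concentration of the energy and consistency\<close>

locale mixed_ou = hurst H + continuous_gaussian_process M \<xi> "hurst.mixed_cov H" \<theta>
  for H and M :: "'a measure" and \<xi> \<theta> +
  assumes theta_pos: "0 < \<theta>"
begin

abbreviation covT :: "real \<Rightarrow> real \<Rightarrow> real \<Rightarrow> real" where
  "covT T \<equiv> covariance_measure.cov (mixed_measure T) \<theta>"

abbreviation B :: real where "B \<equiv> var_bound \<theta>"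

section \<open>Mean and variance of the energy\<close>

lemma B_nonneg: "0 \<le> B"
  unfolding var_bound_def using alpha_pos conv_bound_pos[OF theta_pos] theta_pos by simp

text \<open>The left-hand side does not mention \<open>T\<close>: for times up to the horizon the
  value of \<open>covT T s t\<close> is independent of it, although the measure is truncated at
  \<open>T\<close>.\<close>

lemma expectation_ou_ou:
  assumes "0 \<le> s" "s \<le> T" "0 \<le> t" "t \<le> T"
  shows "expectation (\<lambda>\<omega>. ou s \<omega> * ou t \<omega>) = covT T s t"
proof -
  interpret C: covariance_measure "mixed_measure T" \<theta> T mixed_cov
    using assms theta_pos by (intro mixed_covariance_measure) auto
  show ?thesis using ou_cov[of s t] C.exp_filter_R[of s t] assms by simp
qed

lemma expectation_ou_square:
  "0 \<le> t \<Longrightarrow> t \<le> T \<Longrightarrow> expectation (\<lambda>\<omega>. (ou t \<omega>)\<^sup>2) = covT T t t"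
  using expectation_ou_ou[of t T t] by (simp add: power2_eq_square)

lemma expectation_ou_squares:
  assumes "0 \<le> s" "s \<le> T" "0 \<le> t" "t \<le> T"
  shows "integrable M (\<lambda>\<omega>. (ou s \<omega>)\<^sup>2 * (ou t \<omega>)\<^sup>2)"
    and "expectation (\<lambda>\<omega>. (ou s \<omega>)\<^sup>2 * (ou t \<omega>)\<^sup>2) = covT T s s * covT T t t + 2 * (covT T s t)\<^sup>2"
  using isserlis[OF ou_centered_normal[OF \<open>0 \<le> s\<close> \<open>0 \<le> t\<close>]] assms
  by (auto simp: expectation_ou_square expectation_ou_ou)

definition energy :: "real \<Rightarrow> 'a \<Rightarrow> real" where
  "energy T \<omega> = (\<integral>t. indicator {0..T} t * (ou t \<omega>)\<^sup>2 \<partial>lborel)"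

definition mean_energy :: "real \<Rightarrow> real" where
  "mean_energy T = (\<integral>t. indicator {0..T} t * covT T t t \<partial>lborel)"

lemma energy_measurable [measurable]: "energy T \<in> borel_measurable M"
  unfolding energy_def by measurable

lemma expectation_energy:
  assumes "0 \<le> T"
  shows "integrable M (energy T)" and "expectation (energy T) = mean_energy T"
proof -
  define F where "F t \<omega> = indicator {0..T} t * (ou t \<omega>)\<^sup>2" for t \<omega>
  have [measurable]: "(\<lambda>(t, \<omega>). F t \<omega>) \<in> borel_measurable (lborel \<Otimes>\<^sub>M M)"
    unfolding F_def case_prod_beta' by measurable
  have EF: "expectation (\<lambda>\<omega>. F t \<omega>) = indicator {0..T} t * covT T t t" for t
    by (auto simp: F_def indicator_def expectation_ou_square)
  have F: "integrable (lborel \<Otimes>\<^sub>M M) (\<lambda>(t, \<omega>). F t \<omega>)"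
  proof (rule integrable_pair_bound[where b="\<lambda>t. indicator {0..T} t * B"])
    fix t :: real
    show "integrable M (\<lambda>\<omega>. case (t, \<omega>) of (t, \<omega>) \<Rightarrow> F t \<omega>)"
      using ou_square_integrable[of t] by (cases "0 \<le> t") (auto simp: F_def)
    have "expectation (\<lambda>\<omega>. \<bar>F t \<omega>\<bar>) = expectation (\<lambda>\<omega>. F t \<omega>)"
      by (simp add: F_def)
    also have "\<dots> \<le> indicator {0..T} t * B"
      unfolding EF using cov_le_var_bound[OF theta_pos, of t T t] assms by (auto simp: indicator_def)
    finally show "expectation (\<lambda>\<omega>. \<bar>case (t, \<omega>) of (t, \<omega>) \<Rightarrow> F t \<omega>\<bar>) \<le> indicator {0..T} t * B"
      by simp
  qed (auto simp: emeasure_lborel_Icc_eq intro: sigma_finite_lborel prob_space_imp_sigma_finite prob_space_axioms)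
  interpret pair_sigma_finite lborel M ..
  have eq: "energy T = (\<lambda>\<omega>. \<integral>t. F t \<omega> \<partial>lborel)"
    by (simp add: energy_def[abs_def] F_def)
  show "integrable M (energy T)"
    unfolding eq using integrable_snd[OF F] .
  show "expectation (energy T) = mean_energy T"
    unfolding eq Fubini_integral[OF F] EF mean_energy_def ..
qed

text \<open>Under the double time integral, the product of variances in Isserlis' formula integrates
  to the squared mean and cancels; what remains is twice the integral of the squared
  covariance.\<close>

lemma energy_variance:
  assumes "0 \<le> T"
  shows "integrable M (\<lambda>\<omega>. (energy T \<omega> - mean_energy T)\<^sup>2)"
    and "expectation (\<lambda>\<omega>. (energy T \<omega> - mean_energy T)\<^sup>2) \<le> 2 * B * (mixed_cov T T / \<theta>\<^sup>2)"
proof -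
  interpret C: covariance_measure "mixed_measure T" \<theta> T mixed_cov
    using assms theta_pos by (intro mixed_covariance_measure)
  have c_le: "C.cov s t \<le> B" if "0 \<le> s" "0 \<le> t" for s t
    using that assms by (intro cov_le_var_bound theta_pos)
  have sq_le: "(C.cov s t)\<^sup>2 \<le> B * C.cov s t" if "0 \<le> s" "0 \<le> t" for s t
    using mult_right_mono[OF c_le[OF that] C.cov_nonneg] by (simp add: power2_eq_square)
  let ?N = "lborel \<Otimes>\<^sub>M lborel :: (real \<times> real) measure"
  \<comment> \<open>Both times are carried by one planar variable \<open>z\<close>, so that a single
    exchange with the expectation is enough.\<close>
  define Q where "Q z = (indicator {0..T} (fst z) * indicator {0..T} (snd z) :: real)" for z :: "real \<times> real"
  have [measurable]: "Q \<in> borel_measurable ?N"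
    unfolding Q_def by measurable
  define F where "F z \<omega> = Q z * ((ou (fst z) \<omega>)\<^sup>2 * (ou (snd z) \<omega>)\<^sup>2)" for z \<omega>
  have [measurable]: "(\<lambda>(z, \<omega>). F z \<omega>) \<in> borel_measurable (?N \<Otimes>\<^sub>M M)"
    unfolding F_def case_prod_beta' by measurable
  have EF: "expectation (\<lambda>\<omega>. F z \<omega>) = Q z * (C.cov (fst z) (fst z) * C.cov (snd z) (snd z) + 2 * (C.cov (fst z) (snd z))\<^sup>2)" for z
    by (auto simp: F_def Q_def indicator_def expectation_ou_squares)
  have Q: "integrable ?N Q"
  proof -
    have "Q = indicator ({0..T} \<times> {0..T})"
      by (auto simp: Q_def indicator_def)
    moreover have "emeasure ?N ({0..T} \<times> {0..T}) < \<infinity>"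
      by (subst lborel.emeasure_pair_measure_Times) (auto simp: emeasure_lborel_Icc_eq ennreal_mult_less_top)
    ultimately show ?thesis by simp
  qed
  have sf: "sigma_finite_measure ?N" by (simp add: lborel_prod sigma_finite_lborel)
  have F: "integrable (?N \<Otimes>\<^sub>M M) (\<lambda>(z, \<omega>). F z \<omega>)"
  proof (rule integrable_pair_bound[where b="\<lambda>z. Q z * (3 * B\<^sup>2)"])
    show "integrable ?N (\<lambda>z. Q z * (3 * B\<^sup>2))" using Q by simp
    fix z :: "real \<times> real"
    show "integrable M (\<lambda>\<omega>. case (z, \<omega>) of (z, \<omega>) \<Rightarrow> F z \<omega>)"
    proof (cases "Q z = 0")
      case False
      then have "0 \<le> fst z" "fst z \<le> T" "0 \<le> snd z" "snd z \<le> T"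
        by (auto simp: Q_def indicator_def split: if_splits)
      from expectation_ou_squares(1)[OF this] show ?thesis by (simp add: F_def)
    qed (simp add: F_def)
    have "expectation (\<lambda>\<omega>. \<bar>F z \<omega>\<bar>) = expectation (\<lambda>\<omega>. F z \<omega>)"
      by (simp add: F_def Q_def)
    also have "\<dots> \<le> Q z * (3 * B\<^sup>2)"
    proof (cases "Q z = 0")
      case False
      then have z: "0 \<le> fst z" "0 \<le> snd z" "Q z = 1"
        by (auto simp: Q_def indicator_def split: if_splits)
      have "C.cov (fst z) (fst z) * C.cov (snd z) (snd z) \<le> B * B"
        using z by (intro mult_mono c_le C.cov_nonneg B_nonneg)
      moreover have "(C.cov (fst z) (snd z))\<^sup>2 \<le> B\<^sup>2"
        using z by (intro power_mono c_le C.cov_nonneg)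
      ultimately show ?thesis unfolding EF z(3) by (simp add: power2_eq_square)
    qed (simp add: EF)
    finally show "expectation (\<lambda>\<omega>. \<bar>case (z, \<omega>) of (z, \<omega>) \<Rightarrow> F z \<omega>\<bar>) \<le> Q z * (3 * B\<^sup>2)"
      by simp
  qed (auto intro: sf prob_space_imp_sigma_finite prob_space_axioms)
  interpret P: pair_sigma_finite ?N M
    by (intro pair_sigma_finite.intro sf prob_space_imp_sigma_finite prob_space_axioms)
  \<comment> \<open>The planar integral is factored for paths on which the integrand is integrable,
    hence almost surely.\<close>
  have sq: "AE \<omega> in M. (\<integral>z. F z \<omega> \<partial>?N) = (energy T \<omega>)\<^sup>2"
    using P.AE_integrable_snd[OF F]
  proof eventually_elim
    case (elim \<omega>)
    define f where "f t = indicator {0..T} t * (ou t \<omega>)\<^sup>2" for t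
    have Ff: "(\<lambda>z. F z \<omega>) = (\<lambda>(s, t). f s * f t)"
      by (auto simp: F_def Q_def f_def)
    have "(\<integral>z. F z \<omega> \<partial>?N) = (\<integral>s. (\<integral>t. f s * f t \<partial>lborel) \<partial>lborel)"
      using elim unfolding Ff by (rule lborel_pair.integral_fst[symmetric])
    also have "\<dots> = (integral\<^sup>L lborel f)\<^sup>2"
      by (simp add: power2_eq_square)
    also have "integral\<^sup>L lborel f = energy T \<omega>"
      by (simp add: energy_def f_def[abs_def])
    finally show ?case .
  qed
  have m: "(\<lambda>\<omega>. \<integral>z. F z \<omega> \<partial>?N) \<in> borel_measurable M"
    using P.integrable_snd[OF F] by (rule borel_measurable_integrable)
  have int2: "integrable M (\<lambda>\<omega>. (energy T \<omega>)\<^sup>2)"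
    using P.integrable_snd[OF F] sq m by (subst (asm) integrable_cong_AE) auto
  have E2: "expectation (\<lambda>\<omega>. (energy T \<omega>)\<^sup>2) = (\<integral>z. Q z * (C.cov (fst z) (fst z) * C.cov (snd z) (snd z) + 2 * (C.cov (fst z) (snd z))\<^sup>2) \<partial>?N)"
    using integral_cong_AE[OF m _ sq] P.Fubini_integral[OF F] unfolding EF by simp
  define c where "c z = Q z * (C.cov (fst z) (snd z))\<^sup>2" for z
  define d where "d z = Q z * (C.cov (fst z) (fst z) * C.cov (snd z) (snd z))" for z
  have icov: "integrable ?N (\<lambda>z. Q z * C.cov (fst z) (snd z))"
    using C.cov_double_integral(1) by (simp add: Q_def case_prod_beta')
  have c_bound: "c z \<le> B * (Q z * C.cov (fst z) (snd z))" for z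
    using sq_le[of "fst z" "snd z"] by (auto simp: c_def Q_def indicator_def)
  have c_nonneg: "0 \<le> c z" for z by (simp add: c_def Q_def)
  have ic: "integrable ?N c"
  proof (rule Bochner_Integration.integrable_bound)
    show "integrable ?N (\<lambda>z. B * (Q z * C.cov (fst z) (snd z)))" using icov by simp
    show "AE z in ?N. norm (c z) \<le> norm (B * (Q z * C.cov (fst z) (snd z)))"
      using order_trans[OF c_bound abs_ge_self] c_nonneg by (intro AE_I2) simp
    show "c \<in> borel_measurable ?N" unfolding c_def by measurable
  qed
  have total: "Q z * (C.cov (fst z) (fst z) * C.cov (snd z) (snd z) + 2 * (C.cov (fst z) (snd z))\<^sup>2) = d z + 2 * c z" for z
    by (simp add: c_def d_def algebra_simps)
  have it: "integrable ?N (\<lambda>z. d z + 2 * c z)"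
    using P.integrable_fst[OF F] unfolding EF total .
  \<comment> \<open>Integrability of the product of variances comes by subtraction: the total is
    integrable by Fubini, the squared covariance by \<open>ic\<close>.\<close>
  have id: "integrable ?N d"
    using Bochner_Integration.integrable_diff[OF it integrable_mult_right[OF ic, of 2]] by simp
  have d_eq: "integral\<^sup>L ?N d = (mean_energy T)\<^sup>2"
  proof -
    define f where "f t = indicator {0..T} t * C.cov t t" for t
    have df: "d = (\<lambda>(s, t). f s * f t)"
      by (auto simp: d_def Q_def f_def)
    have "integral\<^sup>L ?N d = (\<integral>s. (\<integral>t. f s * f t \<partial>lborel) \<partial>lborel)"
      using id unfolding df by (rule lborel_pair.integral_fst[symmetric])
    also have "\<dots> = (mean_energy T)\<^sup>2"
      by (simp add: mean_energy_def f_def[symmetric] power2_eq_square)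
    finally show ?thesis .
  qed
  have "expectation (\<lambda>\<omega>. (energy T \<omega>)\<^sup>2) = (mean_energy T)\<^sup>2 + 2 * integral\<^sup>L ?N c"
    unfolding E2 total d_eq[symmetric] using id ic by simp
  moreover have "(\<lambda>\<omega>. (energy T \<omega> - mean_energy T)\<^sup>2) = (\<lambda>\<omega>. (energy T \<omega>)\<^sup>2 - 2 * mean_energy T * energy T \<omega> + (mean_energy T)\<^sup>2)"
    by (auto simp: power2_eq_square algebra_simps)
  ultimately have var: "expectation (\<lambda>\<omega>. (energy T \<omega> - mean_energy T)\<^sup>2) = 2 * integral\<^sup>L ?N c"
    and "integrable M (\<lambda>\<omega>. (energy T \<omega> - mean_energy T)\<^sup>2)"
    using int2 expectation_energy[OF assms] by (auto simp: power2_eq_square prob_space)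
  then show "integrable M (\<lambda>\<omega>. (energy T \<omega> - mean_energy T)\<^sup>2)" by simp
  have "integral\<^sup>L ?N c \<le> (\<integral>z. B * (Q z * C.cov (fst z) (snd z)) \<partial>?N)"
    using ic icov c_bound by (intro integral_mono) auto
  also have "\<dots> = B * (\<integral>z. Q z * C.cov (fst z) (snd z) \<partial>?N)" by simp
  also have "\<dots> \<le> B * (mixed_cov T T / \<theta>\<^sup>2)"
    using C.cov_double_integral(2) mixed_covariance_measure(2)[OF theta_pos assms]
    by (intro mult_left_mono B_nonneg) (simp add: Q_def case_prod_beta')
  finally show "expectation (\<lambda>\<omega>. (energy T \<omega> - mean_energy T)\<^sup>2) \<le> 2 * B * (mixed_cov T T / \<theta>\<^sup>2)"
    unfolding var by simp
qed

text \<open>Halving the energy identity leaves two errors: the mismatch in the correction term and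
  the boundary variance \<open>covT T T T / 2\<close>, which is at most \<open>B / 2\<close>. The
  lower bound holds because the exponential integral against the mixed measure is at least
  \<open>T\<close>.\<close>

lemma mean_energy_corr_term:
  assumes "0 \<le> T"
  shows "\<bar>alpha_H H * corr_term \<theta> H T + T / 2 - \<theta> * mean_energy T\<bar> \<le> 2 * alpha_H H * (T powr (2*H - 1) / ((2*H - 1) * \<theta>)) + B / 2"
    and "T - B \<le> 2 * \<theta> * mean_energy T"
proof -
  interpret C: covariance_measure "mixed_measure T" \<theta> T mixed_cov
    using assms theta_pos by (intro mixed_covariance_measure)
  define E where "E = (\<integral>p. exp (- \<theta> * \<bar>fst p - snd p\<bar>) \<partial>mixed_measure T)"
  have energy: "C.cov T T + 2 * \<theta> * mean_energy T = E"
    using C.cov_energy(2) by (simp add: mean_energy_def E_def)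
  have c: "0 \<le> C.cov T T" "C.cov T T \<le> B"
    using assms by (auto intro: C.cov_nonneg cov_le_var_bound theta_pos)
  have "T \<le> E" unfolding E_def using exp_integral_mixed_measure(2)[OF theta_pos assms] .
  with c energy show "T - B \<le> 2 * \<theta> * mean_energy T" by linarith
  have "\<bar>alpha_H H * corr_term \<theta> H T - (E - T) / 2\<bar> \<le> 2 * alpha_H H * (T powr (2*H - 1) / ((2*H - 1) * \<theta>))"
    unfolding E_def using corr_term_bound[OF theta_pos assms] .
  with c energy show "\<bar>alpha_H H * corr_term \<theta> H T + T / 2 - \<theta> * mean_energy T\<bar> \<le> 2 * alpha_H H * (T powr (2*H - 1) / ((2*H - 1) * \<theta>)) + B / 2"
    by (simp add: abs_le_iff field_simps)
qed

text \<open>Also valid where the energy vanishes: both sides are then 0 by the convention for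
  division by zero.\<close>

lemma lse_ou: "0 \<le> T \<Longrightarrow> lse \<theta> H ou T \<omega> = (- (ou T \<omega>)\<^sup>2 / 2 + alpha_H H * corr_term \<theta> H T + T / 2) / energy T \<omega>"
  using interval_integral_Icc[of 0 T "\<lambda>t. (ou t \<omega>)\<^sup>2"]
  by (simp add: lse_def Let_def energy_def set_lebesgue_integral_def zero_ereal_def add_divide_distrib diff_divide_distrib)

section \<open>Deviation probabilities of the estimator\<close>

lemma lse_measurable: "0 \<le> T \<Longrightarrow> {\<omega>\<in>space M. \<bar>lse \<theta> H ou T \<omega> - \<theta>\<bar> > \<epsilon>} \<in> sets M"
  unfolding lse_ou by measurable

text \<open>Off two events, controlled by the inequalities of Chebyshev (\<open>?A\<close>) and
  Markov (\<open>?D\<close>), the error is bounded deterministically: the energy exceeds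
  \<open>T / (8 * \<theta>)\<close>, and the numerator minus \<open>\<theta> * I\<close> is at most
  \<open>\<kappa> * T * (2 + \<theta>)\<close> in modulus. The quotient of these two is the
  left-hand side of the third condition on \<open>\<kappa>\<close>.\<close>

lemma lse_prob_bound:
  assumes T: "0 < T" and \<kappa>: "0 < \<kappa>" "\<kappa> \<le> 1 / (8 * \<theta>)" "\<kappa> * (2 + \<theta>) * (8 * \<theta>) \<le> \<epsilon>"
    and TB: "2 * B \<le> T"
    and r: "2 * alpha_H H * (T powr (2*H - 1) / ((2*H - 1) * \<theta>)) + B / 2 \<le> \<kappa> * T"
  shows "measure M {\<omega>\<in>space M. \<bar>lse \<theta> H ou T \<omega> - \<theta>\<bar> > \<epsilon>} \<le> 2 * B * (mixed_cov T T / \<theta>\<^sup>2) / (\<kappa> * T)\<^sup>2 + B / (\<kappa> * T)"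
proof -
  let ?A = "{\<omega>\<in>space M. (\<kappa> * T)\<^sup>2 \<le> (energy T \<omega> - mean_energy T)\<^sup>2}"
  let ?D = "{\<omega>\<in>space M. \<kappa> * T \<le> (ou T \<omega>)\<^sup>2}"
  have kT: "0 < \<kappa> * T" using T \<kappa> by simp
  have "measure M ?A \<le> expectation (\<lambda>\<omega>. (energy T \<omega> - mean_energy T)\<^sup>2) / (\<kappa> * T)\<^sup>2"
    using kT T energy_variance(1)[of T] by (intro integral_Markov_inequality_measure[where A="{}"]) auto
  also have "\<dots> \<le> 2 * B * (mixed_cov T T / \<theta>\<^sup>2) / (\<kappa> * T)\<^sup>2"
    using T by (intro divide_right_mono energy_variance) auto
  finally have A: "measure M ?A \<le> 2 * B * (mixed_cov T T / \<theta>\<^sup>2) / (\<kappa> * T)\<^sup>2" .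
  have "measure M ?D \<le> expectation (\<lambda>\<omega>. (ou T \<omega>)\<^sup>2) / (\<kappa> * T)"
    using kT T ou_square_integrable[of T] by (intro integral_Markov_inequality_measure[where A="{}"]) auto
  also have "\<dots> \<le> B / (\<kappa> * T)"
    using kT T cov_le_var_bound[OF theta_pos, of T T T]
    by (intro divide_right_mono) (auto simp: expectation_ou_square[of T T])
  finally have D: "measure M ?D \<le> B / (\<kappa> * T)" .
  have sub: "{\<omega>\<in>space M. \<bar>lse \<theta> H ou T \<omega> - \<theta>\<bar> > \<epsilon>} \<subseteq> ?A \<union> ?D"
  proof (rule subsetI, rule ccontr)
    fix \<omega> assume "\<omega> \<in> {\<omega>\<in>space M. \<bar>lse \<theta> H ou T \<omega> - \<theta>\<bar> > \<epsilon>}" "\<omega> \<notin> ?A \<union> ?D"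
    then have gt: "\<bar>lse \<theta> H ou T \<omega> - \<theta>\<bar> > \<epsilon>" and ou: "(ou T \<omega>)\<^sup>2 < \<kappa> * T"
      and en: "(energy T \<omega> - mean_energy T)\<^sup>2 < (\<kappa> * T)\<^sup>2" by auto
    define I where "I = energy T \<omega>"
    define m where "m = mean_energy T"
    define q where "q = alpha_H H * corr_term \<theta> H T + T / 2 - \<theta> * m"
    have Im: "\<bar>I - m\<bar> < \<kappa> * T"
      using kT en abs_le_square_iff[of "\<kappa> * T" "I - m"] by (auto simp: I_def m_def not_le[symmetric])
    have q: "\<bar>q\<bar> \<le> \<kappa> * T"
      using mean_energy_corr_term(1)[of T] r T by (simp add: q_def m_def)
    \<comment> \<open>The condition \<open>2 * B \<le> T\<close> lowers \<open>T - B\<close> to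
      \<open>T / 2\<close>. Half of the resulting \<open>T / (4 * \<theta>)\<close> then absorbs the
      fluctuation of the energy.\<close>
    have "T / 2 \<le> 2 * \<theta> * m"
      using mean_energy_corr_term(2)[of T] TB T by (simp add: m_def)
    then have "T / (4 * \<theta>) \<le> m"
      using theta_pos by (simp add: field_simps)
    moreover have "\<kappa> * T \<le> T / (8 * \<theta>)"
      using mult_right_mono[OF \<kappa>(2), of T] T by simp
    moreover have "T / (4 * \<theta>) = T / (8 * \<theta>) + T / (8 * \<theta>)"
      using theta_pos by (simp add: field_simps)
    ultimately have I: "T / (8 * \<theta>) < I" using Im by linarith
    have pos: "0 < T / (8 * \<theta>)" using T theta_pos by simp
    have "lse \<theta> H ou T \<omega> - \<theta> = (- (ou T \<omega>)\<^sup>2 / 2 + q - \<theta> * (I - m)) / I"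
      using I pos T by (simp add: lse_ou I_def[symmetric] q_def field_simps)
    then have "\<bar>lse \<theta> H ou T \<omega> - \<theta>\<bar> = \<bar>- (ou T \<omega>)\<^sup>2 / 2 + q - \<theta> * (I - m)\<bar> / I"
      using I pos by simp
    also have "\<dots> \<le> (\<kappa> * T * (2 + \<theta>)) / (T / (8 * \<theta>))"
    proof (rule frac_le)
      \<comment> \<open>In units of \<open>\<kappa> * T\<close> the three terms contribute at most
        1/2, 1 and \<theta>; the sum is rounded up to \<open>2 + \<theta>\<close>.\<close>
      have "\<theta> * \<bar>I - m\<bar> \<le> \<theta> * (\<kappa> * T)"
        using Im theta_pos by (intro mult_left_mono) auto
      then have "\<bar>\<theta> * (I - m)\<bar> \<le> \<theta> * (\<kappa> * T)"
        using theta_pos by (simp add: abs_mult)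
      moreover have "\<kappa> * T * (2 + \<theta>) = 2 * (\<kappa> * T) + \<theta> * (\<kappa> * T)"
        by (simp add: algebra_simps)
      moreover have "0 \<le> (ou T \<omega>)\<^sup>2" by simp
      ultimately show "\<bar>- (ou T \<omega>)\<^sup>2 / 2 + q - \<theta> * (I - m)\<bar> \<le> \<kappa> * T * (2 + \<theta>)"
        using q ou unfolding abs_le_iff by linarith
    qed (use I pos kT theta_pos in auto)
    also have "\<dots> = \<kappa> * (2 + \<theta>) * (8 * \<theta>)" using T by simp
    also have "\<dots> \<le> \<epsilon>" by (rule \<kappa>)
    finally show False using gt by simp
  qed
  have [measurable]: "?A \<in> sets M" "?D \<in> sets M" by measurable
  have "measure M {\<omega>\<in>space M. \<bar>lse \<theta> H ou T \<omega> - \<theta>\<bar> > \<epsilon>} \<le> measure M (?A \<union> ?D)"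
    using sub by (rule finite_measure_mono) auto
  also have "\<dots> \<le> measure M ?A + measure M ?D"
    by (rule measure_Un_le) auto
  finally show ?thesis using A D by linarith
qed

lemma lse_tendsto:
  assumes "0 < \<epsilon>"
  shows "((\<lambda>T. measure M {\<omega>\<in>space M. \<bar>lse \<theta> H ou T \<omega> - \<theta>\<bar> > \<epsilon>}) \<longlongrightarrow> 0) at_top"
proof -
  \<comment> \<open>The largest value that meets both upper bounds on \<open>\<kappa>\<close> in
    \<open>lse_prob_bound\<close>.\<close>
  define \<kappa> where "\<kappa> = min (1 / (8 * \<theta>)) (\<epsilon> / ((2 + \<theta>) * (8 * \<theta>)))"
  have "\<kappa> \<le> \<epsilon> / ((2 + \<theta>) * (8 * \<theta>))" by (simp add: \<kappa>_def)
  then have \<kappa>3: "\<kappa> * (2 + \<theta>) * (8 * \<theta>) \<le> \<epsilon>"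
    using theta_pos by (simp add: pos_le_divide_eq mult.assoc)
  have \<kappa>: "0 < \<kappa>" "\<kappa> \<le> 1 / (8 * \<theta>)"
    using theta_pos assms by (auto simp: \<kappa>_def)
  have p: "((\<lambda>T::real. T powr (2*H - 2)) \<longlongrightarrow> 0) at_top"
    using H_lt by (intro tendsto_neg_powr filterlim_ident) auto
  have i: "((\<lambda>T::real. inverse T) \<longlongrightarrow> 0) at_top"
    by (rule tendsto_inverse_0_at_top[OF filterlim_ident])
  \<comment> \<open>The coefficient of \<open>T powr (2*H - 2)\<close> once the deterministic error
    has been divided by \<open>T\<close>.\<close>
  define K where "K = 2 * alpha_H H / ((2*H - 1) * \<theta>)"
  have "((\<lambda>T. K * T powr (2*H - 2) + B / 2 * inverse T) \<longlongrightarrow> K * 0 + B / 2 * 0) at_top"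
    by (intro tendsto_intros p i)
  then have "\<forall>\<^sub>F T in at_top. K * T powr (2*H - 2) + B / 2 * inverse T < \<kappa>"
    using \<kappa> by (intro order_tendstoD(2)[of _ 0]) auto
  then have ev: "\<forall>\<^sub>F T in at_top. measure M {\<omega>\<in>space M. \<bar>lse \<theta> H ou T \<omega> - \<theta>\<bar> > \<epsilon>}
      \<le> 2 * B * (mixed_cov T T / \<theta>\<^sup>2) / (\<kappa> * T)\<^sup>2 + B / (\<kappa> * T)"
    using eventually_gt_at_top[of 0] eventually_ge_at_top[of "2 * B"]
  proof eventually_elim
    case (elim T)
    have "T powr (2*H - 1) = T * T powr (2*H - 2)"
      using powr_add[of T 1 "2*H - 2"] elim by simp
    then have "2 * alpha_H H * (T powr (2*H - 1) / ((2*H - 1) * \<theta>)) + B / 2 = (K * T powr (2*H - 2) + B / 2 * inverse T) * T"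
      using elim by (simp add: K_def field_simps)
    also have "\<dots> \<le> \<kappa> * T" using elim by (intro mult_right_mono) auto
    finally show ?case using elim \<kappa> \<kappa>3 by (intro lse_prob_bound)
  qed
  define c where "c = 2 - 2 powr (2*H) / 2"
  \<comment> \<open>The probability bound in powers of \<open>T\<close>: the variance grows at most
    like a combination of \<open>T\<close> and \<open>T powr (2*H)\<close>, and dividing by the
    square of \<open>T\<close> leaves the negative exponents -1 and \<open>2*H - 2\<close>.\<close>
  have "((\<lambda>T. 2 * B / (\<theta>\<^sup>2 * \<kappa>\<^sup>2) * (inverse T + c * T powr (2*H - 2)) + B / \<kappa> * inverse T)
     \<longlongrightarrow> 2 * B / (\<theta>\<^sup>2 * \<kappa>\<^sup>2) * (0 + c * 0) + B / \<kappa> * 0) at_top"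
    by (intro tendsto_intros p i)
  moreover have "\<forall>\<^sub>F T in at_top. 2 * B / (\<theta>\<^sup>2 * \<kappa>\<^sup>2) * (inverse T + c * T powr (2*H - 2)) + B / \<kappa> * inverse T
      = 2 * B * (mixed_cov T T / \<theta>\<^sup>2) / (\<kappa> * T)\<^sup>2 + B / (\<kappa> * T)"
    using eventually_gt_at_top[of 0]
  proof eventually_elim
    case (elim T)
    have "T powr (2*H) = T\<^sup>2 * T powr (2*H - 2)"
      using powr_add[of T 2 "2*H - 2"] elim by simp
    then have "mixed_cov T T = T + c * (T\<^sup>2 * T powr (2*H - 2))"
      using mixed_cov_diag[of T] elim by (simp add: c_def)
    then show ?case
      using elim \<kappa>(1) theta_pos by (simp add: field_simps power2_eq_square)
  qed
  ultimately have "((\<lambda>T. 2 * B * (mixed_cov T T / \<theta>\<^sup>2) / (\<kappa> * T)\<^sup>2 + B / (\<kappa> * T)) \<longlongrightarrow> 0) at_top"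
    by (subst (asm) filterlim_cong[OF refl refl]) auto
  then show ?thesis
    by (rule tendsto_sandwich[OF _ ev tendsto_const, rotated]) simp
qed

end

text \<open>A finite linear combination is a measurable functional \<open>f\<close> of the path in
  the product space, so independence of the paths passes to the combinations and their
  characteristic functions multiply.\<close>

lemma (in prob_space) centered_gaussian_process_add:
  assumes W: "centered_gaussian_process M W C" and S: "centered_gaussian_process M S D"
    and indep: "indep_processes M W S"
  shows "centered_gaussian_process M (\<lambda>t \<omega>. W t \<omega> + S t \<omega>) (\<lambda>s t. C s t + D s t)"
  unfolding centered_gaussian_process_def
proof (intro conjI allI impI)
  show "(\<lambda>\<omega>. W t \<omega> + S t \<omega>) \<in> borel_measurable M" if "0 \<le> t" for t
    using W S that by (intro borel_measurable_add) (auto simp: centered_gaussian_process_def)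
next
  fix ts cs :: "real list" and u :: real
  assume len: "length cs = length ts" and nn: "\<forall>t\<in>set ts. 0 \<le> t"
  define f where "f p = (\<Sum>i<length ts. cs!i * p (ts!i))" for p :: "real \<Rightarrow> real"
  have [measurable]: "f \<in> borel_measurable (Pi\<^sub>M {0..} (\<lambda>_. borel))"
    unfolding f_def using nn
    by (intro borel_measurable_sum borel_measurable_times borel_measurable_const measurable_component_singleton) auto
  have f: "f (\<lambda>t\<in>{0..}. Y t \<omega>) = (\<Sum>i<length ts. cs!i * Y (ts!i) \<omega>)" for Y :: "real \<Rightarrow> 'a \<Rightarrow> real" and \<omega>
    unfolding f_def using nn by (intro sum.cong) auto
  have "indep_var borel (f \<circ> (\<lambda>\<omega>. \<lambda>t\<in>{0..}. W t \<omega>)) borel (f \<circ> (\<lambda>\<omega>. \<lambda>t\<in>{0..}. S t \<omega>))"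
    by (rule indep_var_compose[OF indep[unfolded indep_processes_def]]) measurable
  then have "indep_var borel (\<lambda>\<omega>. \<Sum>i<length ts. cs!i * W (ts!i) \<omega>) borel (\<lambda>\<omega>. \<Sum>i<length ts. cs!i * S (ts!i) \<omega>)"
    by (simp add: comp_def f)
  from char_distr_add[OF this, of u]
  have "char (distr M borel (\<lambda>\<omega>. \<Sum>i<length ts. cs!i * (W (ts!i) \<omega> + S (ts!i) \<omega>))) u
    = char (distr M borel (\<lambda>\<omega>. \<Sum>i<length ts. cs!i * W (ts!i) \<omega>)) u * char (distr M borel (\<lambda>\<omega>. \<Sum>i<length ts. cs!i * S (ts!i) \<omega>)) u"
    by (simp add: sum.distrib distrib_left)
  also have "\<dots> = complex_of_real (exp (- (\<Sum>i<length ts. \<Sum>j<length ts. cs!i * cs!j * C (ts!i) (ts!j)) * u\<^sup>2 / 2))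
     * complex_of_real (exp (- (\<Sum>i<length ts. \<Sum>j<length ts. cs!i * cs!j * D (ts!i) (ts!j)) * u\<^sup>2 / 2))"
    using W S len nn unfolding centered_gaussian_process_def by simp
  also have "\<dots> = complex_of_real (exp (- (\<Sum>i<length ts. \<Sum>j<length ts. cs!i * cs!j * (C (ts!i) (ts!j) + D (ts!i) (ts!j))) * u\<^sup>2 / 2))"
    by (simp add: sum.distrib distrib_left distrib_right left_diff_distrib add_divide_distrib diff_divide_distrib flip: of_real_mult exp_add)
  finally show "char (distr M borel (\<lambda>\<omega>. \<Sum>i<length ts. cs!i * (W (ts!i) \<omega> + S (ts!i) \<omega>))) u
    = complex_of_real (exp (- (\<Sum>i<length ts. \<Sum>j<length ts. cs!i * cs!j * (C (ts!i) (ts!j) + D (ts!i) (ts!j))) * u\<^sup>2 / 2))" .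
qed

theorem theorem3p2:
  fixes M :: "'a measure" and W S :: "real \<Rightarrow> 'a \<Rightarrow> real" and \<theta> H :: real
  assumes "prob_space M"
    and "brownian_motion M W"
    and "sub_fbm M H S"
    and "indep_processes M W S"
    and "\<theta> > 0" and "1/2 < H" and "H < 1"
  shows "\<forall>\<epsilon>>0.
     (\<forall>T>0. {\<omega>\<in>space M. \<bar>lse \<theta> H (msfOU \<theta> W S) T \<omega> - \<theta>\<bar> > \<epsilon>} \<in> sets M) \<and>
     ((\<lambda>T. measure M {\<omega>\<in>space M. \<bar>lse \<theta> H (msfOU \<theta> W S) T \<omega> - \<theta>\<bar> > \<epsilon>})
        \<longlongrightarrow> 0) at_top"
proof -
  interpret prob_space M by fact
  interpret hurst H by (rule hurst.intro) fact+
  define \<xi> where "\<xi> t \<omega> = W t \<omega> + S t \<omega>" for t \<omega>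
  interpret mixed_ou H M \<xi> \<theta>
  proof unfold_locales
    have "centered_gaussian_process M \<xi> (\<lambda>s t. min s t + subfBm_cov H s t)"
      unfolding \<xi>_def using assms
      by (intro centered_gaussian_process_add) (auto simp: brownian_motion_def sub_fbm_def)
    then show "centered_gaussian_process M \<xi> mixed_cov"
      by (simp add: mixed_cov_def[abs_def])
    show "continuous_on {0..} (\<lambda>t. \<xi> t \<omega>)" if "\<omega> \<in> space M" for \<omega>
      unfolding \<xi>_def using assms that
      by (intro continuous_on_add) (auto simp: brownian_motion_def sub_fbm_def)
    show "mixed_cov s t = mixed_cov t s" for s t
      by (simp add: mixed_cov_def subfBm_cov_def min.commute abs_minus_commute add.commute)
    show "\<exists>b. \<forall>t\<in>{0..T}. mixed_cov t t \<le> b" for T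
    proof (intro exI[of _ "T + 2 * T powr (2*H)"] ballI)
      fix t assume t: "t \<in> {0..T}"
      \<comment> \<open>The coefficient from \<open>mixed_cov_diag\<close> is at most 2, which
        explains the bound chosen above.\<close>
      have "(2 - 2 powr (2*H) / 2) * t powr (2*H) \<le> 2 * T powr (2*H)"
        using t H_gt by (intro mult_mono powr_mono2) auto
      then show "mixed_cov t t \<le> T + 2 * T powr (2*H)"
        using t by (simp add: mixed_cov_diag)
    qed
  qed fact
  have msf: "msfOU \<theta> W S t \<omega> = ou t \<omega>" if "0 \<le> t" for t \<omega>
  proof -
    have "ou t \<omega> = exp_filter \<theta> t (\<lambda>s. \<xi> s \<omega>)"
      unfolding ou_def using that by (intro exp_filter_cong) (auto simp: noise_def)
    then show ?thesis
      using that by (simp add: exp_filter_eq_LBINT msfOU_def \<xi>_def)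
  qed
  have lse_eq: "lse \<theta> H (msfOU \<theta> W S) T \<omega> = lse \<theta> H ou T \<omega>" if "0 < T" for T \<omega>
  proof -
    \<comment> \<open>The two processes have been identified at nonnegative times, and the interval
      integral sees no others.\<close>
    have "(LBINT t=0..T. (msfOU \<theta> W S t \<omega>)\<^sup>2) = (LBINT t=0..T. (ou t \<omega>)\<^sup>2)"
      using that by (intro interval_integral_cong) (auto simp: msf einterval_iff min_def split: if_splits)
    then show ?thesis using that by (simp add: lse_def msf)
  qed
  show ?thesis
  proof (intro allI impI conjI)
    fix \<epsilon> :: real assume "0 < \<epsilon>"
    show "{\<omega>\<in>space M. \<bar>lse \<theta> H (msfOU \<theta> W S) T \<omega> - \<theta>\<bar> > \<epsilon>} \<in> sets M" if "0 < T" for T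
      using that lse_measurable[of T \<epsilon>] by (simp add: lse_eq)
    show "((\<lambda>T. measure M {\<omega>\<in>space M. \<bar>lse \<theta> H (msfOU \<theta> W S) T \<omega> - \<theta>\<bar> > \<epsilon>}) \<longlongrightarrow> 0) at_top"
    proof (rule Lim_transform_eventually[OF lse_tendsto[OF \<open>0 < \<epsilon>\<close>]])
      show "\<forall>\<^sub>F T in at_top. measure M {\<omega>\<in>space M. \<bar>lse \<theta> H ou T \<omega> - \<theta>\<bar> > \<epsilon>}
        = measure M {\<omega>\<in>space M. \<bar>lse \<theta> H (msfOU \<theta> W S) T \<omega> - \<theta>\<bar> > \<epsilon>}"
        using eventually_gt_at_top[of 0] by eventually_elim (simp add: lse_eq)
    qed
  qed
qed

end
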